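(* Assume that the operators $\mathcal{K}$, $(\mathcal{K}_j)_{j\ge0}$ satisfy the smoothed approximation condition (SAC) stated in the context, and let $0\le j_0<j$ be fixed indices. Let $\mathcal{I}^{(j)}\subseteq\{1,\dots,N_j\}$ be an inactive set, and consider the coarser inactive index sets and inactive domains and the sequence of operators $\mathcal{Z}_k$, $j_0\le k\le j$, defined in the context. Denote $\mu_k=\mu(\Omega_{k-1}^{\mathrm{I}}\setminus\Omega_k^{\mathrm{I}})$, and assume there exists $0<f\le f_{low}$ so that $\mu_k\le\mu_{k-1}\le f^{-1}\mu_k$ for $k=j_0+1,j_0+2,\dots,j$. Let $C_{\mathrm{tg}}$ be the constant of the two-grid estimate (TG) recalled in the context. If $$C_{\mathrm{tg}}\,\beta^{-1}(h_{j_0}+\mu_{j_0})<\min(0.1,\,f/8),$$ then there exists $C_{\mathrm{mg}}>0$, independent of $j$ and of the inactive set $\mathcal{I}^{(j)}$, so that $$d_{\mathcal{U}_j^{\mathrm{I}}}\left(\mathcal{Z}_j,(\mathcal{H}_j^{\mathrm{I}})^{-1}\right)\le C_{\mathrm{mg}}\,\beta^{-1}(h_j+\mu_j).$$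
   Context: Setting. $\Omega\subset\mathbb{R}^n$ is a bounded polygonal or polyhedral domain, $\mathcal{U}=L^2(\Omega)$ with inner product $\langle\cdot,\cdot\rangle$ and norm $\|\cdot\|=\|\cdot\|_0$ (also used for operator norms), $\mathcal{V}=H_0^1(\Omega)$ with norm $\|\cdot\|_1$, and $\mu$ is Lebesgue measure on $\mathbb{R}^n$. $\mathfrak{L}(X,Y)$ denotes the bounded linear operators from $X$ to $Y$, and $\mathfrak{L}(X)=\mathfrak{L}(X,X)$. $(\mathcal{T}_j)_{j\in\mathbb{N}}$ ($\mathbb{N}=\{0,1,2,\dots\}$) is a family of shape-regular, nested triangulations of $\Omega$ ($\mathcal{T}_{j+1}$ refines $\mathcal{T}_j$), $h_j=\max_{T\in\mathcal{T}_j}\mathrm{diam}(T)$, and $f_{low}\le h_{j+1}/h_j\le f_{high}$ for some $0<f_{low}\le f_{high}<1$ independent of $j$. $\mathcal{U}_j\subset\mathcal{U}$ is the space of piecewise constant functions with respect to $\mathcal{T}_j$, $N_j=\dim\mathcal{U}_j$, with standard basis $\varphi^{(j)}_1,\dots,\varphi^{(j)}_{N_j}$ ($\varphi_i^{(j)}$ is the indicator function of the $i$-th element of $\mathcal{T}_j$). $\mathcal{K}:\mathcal{U}\to\mathcal{V}$ is linear and continuous; $\mathcal{K}_j\in\mathfrak{L}(\mathcal{U}_j,\mathcal{V}_j)$ are discretizations of $\mathcal{K}$, where $\mathcal{V}_j\subset L^2(\Omega)$ is a finite element space (not necessarily contained in $\mathcal{V}$). Adjoints $^*$ are with respect to the $L^2$-inner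 product. $\beta>0$ is the regularization parameter. SAC. There is a constant $C_1$, depending on $\Omega,\mathcal{T}_0$ and independent of $j$, such that: [a] $\max(\|\mathcal{K}^*u\|_m,\|\mathcal{K}u\|_m)\le C_1\|u\|$ for all $u\in L^2(\Omega)$, $m=0,1$; [b] $\|\mathcal{K}u-\mathcal{K}_ju\|\le C_1h_j\|u\|$ for all $u\in\mathcal{U}_j$, $j\in\mathbb{N}$; [c] $\|\mathcal{K}_ju\|_{L^\infty(\Omega)}\le C_1\|u\|$ for all $u\in\mathcal{U}_j$, $j\in\mathbb{N}$. Inactive sets. Given $\mathcal{I}^{(j)}$, set $\Omega_j^{\mathrm{I}}=\bigcup_{i\in\mathcal{I}^{(j)}}\mathrm{supp}(\varphi_i^{(j)})$ and recursively, for $k=j-1,j-2,\dots,j_0$, $\mathcal{I}^{(k)}=\{i\in\{1,\dots,N_k\}:\mu(\mathrm{supp}(\varphi_i^{(k)})\cap\Omega_{k+1}^{\mathrm{I}})>0\}$ and $\Omega_k^{\mathrm{I}}=\bigcup_{i\in\mathcal{I}^{(k)}}\mathrm{supp}(\varphi_i^{(k)})$. The set $\Omega_{j_0-1}^{\mathrm{I}}$ entering $\mu_{j_0}$ is understood as given by the same rule applied once more (when $j_0=0$ this presupposes a triangulation $\mathcal{T}_{-1}$ of $\Omega$ of which $\mathcal{T}_0$ is a refinement). For $k=j_0,\dots,j$: $\mathcal{U}_k^{\mathrm{I}}=\mathrm{span}\{\varphi_i^{(k)}:i\in\mathcal{I}^{(k)}\}$, $\pi_k^{\mathrm{I}}$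 is the $L^2$-orthogonal projection onto $\mathcal{U}_k^{\mathrm{I}}$, $\mathcal{E}_k^{\mathrm{I}}:\mathcal{U}_k^{\mathrm{I}}\to\mathcal{U}_k$ is the extension (inclusion) operator, and $\mathcal{H}_k^{\mathrm{I}}=\pi_k^{\mathrm{I}}(\mathcal{K}_k^*\mathcal{K}_k+\beta I)\mathcal{E}_k^{\mathrm{I}}\in\mathfrak{L}(\mathcal{U}_k^{\mathrm{I}})$. Operators. $\mathfrak{I}_{k-1}^k:\mathfrak{L}(\mathcal{U}_{k-1}^{\mathrm{I}})\to\mathfrak{L}(\mathcal{U}_k^{\mathrm{I}})$, $\mathfrak{I}_{k-1}^k(\mathcal{X})=\pi_k^{\mathrm{I}}\left(\mathcal{X}\pi_{k-1}^{\mathrm{I}}+\beta^{-1}(I-\pi_{k-1}^{\mathrm{I}})\right)$; $\mathfrak{N}_k:\mathfrak{L}(\mathcal{U}_k^{\mathrm{I}})\to\mathfrak{L}(\mathcal{U}_k^{\mathrm{I}})$, $\mathfrak{N}_k(\mathcal{X})=2\mathcal{X}-\mathcal{X}\mathcal{H}_k^{\mathrm{I}}\mathcal{X}$. Multigrid preconditioner. $\mathcal{Z}_{j_0}=(\mathcal{H}_{j_0}^{\mathrm{I}})^{-1}$; $\mathcal{Z}_k=\mathfrak{N}_k(\mathfrak{I}_{k-1}^k(\mathcal{Z}_{k-1}))$ for $j_0+1\le k\le j-1$ (if any); $\mathcal{Z}_j=\mathfrak{I}_{j-1}^j(\mathcal{Z}_{j-1})$. Spectral distance. For a Hilbert space $\mathcal{X}$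 and symmetric positive definite $A,B\in\mathfrak{L}(\mathcal{X})$, $d_{\mathcal{X}}(A,B)=\sup_{u\in\mathcal{X}\setminus\{0\}}\left|\ln\frac{\langle Au,u\rangle}{\langle Bu,u\rangle}\right|$. (TG) Two-grid estimate, an earlier theorem which fixes the constant $C_{\mathrm{tg}}$. Under SAC there exist constants $\delta>0$ and $C_{\mathrm{tg}}>0$, independent of the level $k$ and of the inactive set $\mathcal{I}^{(k)}$, such that, with $\mathcal{I}^{(k-1)}$ and $\Omega_{k-1}^{\mathrm{I}}$ generated from $\mathcal{I}^{(k)}$ by the rule above, if $\beta^{-1}(h_k+\mu(\Omega_{k-1}^{\mathrm{I}}\setminus\Omega_k^{\mathrm{I}}))<\delta$, then $d_{\mathcal{U}_k^{\mathrm{I}}}\left(\mathfrak{I}_{k-1}^k((\mathcal{H}_{k-1}^{\mathrm{I}})^{-1}),(\mathcal{H}_k^{\mathrm{I}})^{-1}\right)\le C_{\mathrm{tg}}\beta^{-1}(h_k+\mu(\Omega_{k-1}^{\mathrm{I}}\setminus\Omega_k^{\mathrm{I}}))$.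
   Formalization: The constant C_tg is not an arbitrary constant admissible in (TG) but a suitably chosen, sufficiently large one (with C_tg·δ ≥ 1/10) for which (TG) still holds; for arbitrary admissible δ and C_tg the claim can fail on coarse levels where the premise of (TG) is not met. *)

theory Defs
  imports "HOL-Analysis.Analysis" "HOL-Probability.Essential_Supremum"
begin

definition square_integrable :: "('a::euclidean_space \<Rightarrow> real) \<Rightarrow> bool" where
  "square_integrable f \<longleftrightarrow>
     f \<in> borel_measurable lebesgue \<and> integrable lebesgue (\<lambda>x. (f x)\<^sup>2)"

definition L2_rel :: "('a::euclidean_space \<Rightarrow> real) \<Rightarrow> ('a \<Rightarrow> real) \<Rightarrow> bool" where
  "L2_rel f g \<longleftrightarrow>
     square_integrable f \<and> square_integrable g \<and> (AE x in lebesgue. f x = g x)"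

lemma square_integrable_measurable:
  "square_integrable f \<Longrightarrow> f \<in> borel_measurable lebesgue"
  by (simp add: square_integrable_def)

lemma square_integrable_0: "square_integrable (\<lambda>_. 0)"
  by (simp add: square_integrable_def)

lemma square_integrable_scale:
  assumes "square_integrable f"
  shows "square_integrable (\<lambda>x. c * f x)"
  using assms by (auto simp: square_integrable_def power_mult_distrib)

lemma square_integrable_prod:
  assumes f: "square_integrable f" and g: "square_integrable g"
  shows "integrable lebesgue (\<lambda>x. f x * g x)"
proof (rule Bochner_Integration.integrable_bound)
  show "integrable lebesgue (\<lambda>x. (f x)\<^sup>2 + (g x)\<^sup>2)"
    using f g by (simp add: square_integrable_def)
  show "(\<lambda>x. f x * g x) \<in> borel_measurable lebesgue"
    using f g by (intro borel_measurable_times square_integrable_measurable)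
  have "\<bar>a * b\<bar> \<le> a\<^sup>2 + b\<^sup>2" for a b :: real
  proof -
    have "0 \<le> (\<bar>a\<bar> - \<bar>b\<bar>)\<^sup>2" by simp
    then have "2 * (\<bar>a\<bar> * \<bar>b\<bar>) \<le> a\<^sup>2 + b\<^sup>2"
      by (simp add: power2_diff)
    moreover have "0 \<le> \<bar>a\<bar> * \<bar>b\<bar>" by simp
    ultimately show ?thesis unfolding abs_mult by linarith
  qed
  then show "AE x in lebesgue. norm (f x * g x) \<le> norm ((f x)\<^sup>2 + (g x)\<^sup>2)"
    by simp
qed

lemma square_integrable_add:
  assumes f: "square_integrable f" and g: "square_integrable g"
  shows "square_integrable (\<lambda>x. f x + g x)"
proof -
  have "integrable lebesgue (\<lambda>x. (f x)\<^sup>2 + 2 * (f x * g x) + (g x)\<^sup>2)"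
    using f g square_integrable_prod[OF f g] by (simp add: square_integrable_def)
  moreover have "(\<lambda>x. (f x)\<^sup>2 + 2 * (f x * g x) + (g x)\<^sup>2) = (\<lambda>x. (f x + g x)\<^sup>2)"
    by (auto simp: power2_sum)
  moreover have "(\<lambda>x. f x + g x) \<in> borel_measurable lebesgue"
    using f g by (intro borel_measurable_add square_integrable_measurable)
  ultimately show ?thesis
    by (simp add: square_integrable_def)
qed

lemma square_integrable_uminus:
  assumes "square_integrable f"
  shows "square_integrable (\<lambda>x. - f x)"
  using square_integrable_scale[OF assms, of "-1"] by simp

lemma square_integrable_diff:
  assumes f: "square_integrable f" and g: "square_integrable g"
  shows "square_integrable (\<lambda>x. f x - g x)"
  using square_integrable_add[OF f square_integrable_uminus[OF g]] by simp

text \<open>Elements of \<open>'a L2\<close> are classes, modulo equality almost everywhere, of square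
  integrable functions on the whole space.\<close>

quotient_type (overloaded) 'a L2 = "'a::euclidean_space \<Rightarrow> real" / partial: L2_rel
proof (rule part_equivpI)
  show "\<exists>x::'a \<Rightarrow> real. L2_rel x x"
    by (rule exI[of _ "\<lambda>_. 0"]) (simp add: L2_rel_def square_integrable_0)
  show "symp (L2_rel :: ('a \<Rightarrow> real) \<Rightarrow> _)"
    by (auto intro!: sympI simp: L2_rel_def eq_commute)
  show "transp (L2_rel :: ('a \<Rightarrow> real) \<Rightarrow> _)"
  proof (rule transpI)
    fix f g h :: "'a \<Rightarrow> real"
    assume "L2_rel f g" "L2_rel g h"
    then have f: "square_integrable f" and h: "square_integrable h"
      and fg: "AE x in lebesgue. f x = g x" and gh: "AE x in lebesgue. g x = h x"
      by (simp_all add: L2_rel_def)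
    from fg gh have "AE x in lebesgue. f x = h x"
      by eventually_elim simp
    with f h show "L2_rel f h" by (simp add: L2_rel_def)
  qed
qed

instantiation L2 :: (euclidean_space) real_inner
begin

lift_definition zero_L2 :: "'a L2" is "\<lambda>_. 0"
  by (simp add: L2_rel_def square_integrable_0)

lift_definition plus_L2 :: "'a L2 \<Rightarrow> 'a L2 \<Rightarrow> 'a L2" is "\<lambda>f g x. f x + g x"
  unfolding L2_rel_def by (auto intro: square_integrable_add)

lift_definition uminus_L2 :: "'a L2 \<Rightarrow> 'a L2" is "\<lambda>f x. - f x"
  unfolding L2_rel_def by (auto intro: square_integrable_uminus)

lift_definition minus_L2 :: "'a L2 \<Rightarrow> 'a L2 \<Rightarrow> 'a L2" is "\<lambda>f g x. f x - g x"
  unfolding L2_rel_def by (auto intro: square_integrable_diff)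

lift_definition scaleR_L2 :: "real \<Rightarrow> 'a L2 \<Rightarrow> 'a L2" is "\<lambda>c f x. c * f x"
  unfolding L2_rel_def by (auto intro: square_integrable_scale)

lift_definition inner_L2 :: "'a L2 \<Rightarrow> 'a L2 \<Rightarrow> real" is
  "\<lambda>f g. integral\<^sup>L lebesgue (\<lambda>x. f x * g x)"
  unfolding L2_rel_def
  by (rule integral_cong_AE) (auto simp: square_integrable_def)

definition norm_L2 :: "'a L2 \<Rightarrow> real" where "norm_L2 u = sqrt (inner u u)"
definition dist_L2 :: "'a L2 \<Rightarrow> 'a L2 \<Rightarrow> real" where "dist_L2 u v = norm (u - v)"
definition sgn_L2 :: "'a L2 \<Rightarrow> 'a L2" where "sgn_L2 u = inverse (norm u) *\<^sub>R u"
definition uniformity_L2 :: "('a L2 \<times> 'a L2) filter" where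
  "uniformity_L2 = (INF e\<in>{0 <..}. principal {(u, v). dist u v < e})"
definition open_L2 :: "'a L2 set \<Rightarrow> bool" where
  "open_L2 U = (\<forall>u\<in>U. eventually (\<lambda>(u', v). u' = u \<longrightarrow> v \<in> U) uniformity)"

instance
proof
  fix u v w :: "'a L2" and a b :: real
  show "u + v + w = u + (v + w)"
    by transfer (auto simp: L2_rel_def algebra_simps intro!: square_integrable_add)
  show "u + v = v + u"
    by transfer (auto simp: L2_rel_def algebra_simps intro!: square_integrable_add)
  show "0 + u = u"
    by transfer (auto simp: L2_rel_def)
  show "- u + u = 0"
    by transfer (auto simp: L2_rel_def square_integrable_0)
  show "u - v = u + - v"
    by transfer (auto simp: L2_rel_def intro!: square_integrable_diff)
  show "a *\<^sub>R (u + v) = a *\<^sub>R u + a *\<^sub>R v"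
    by transfer (auto simp: L2_rel_def algebra_simps
        intro!: square_integrable_add square_integrable_scale)
  show "(a + b) *\<^sub>R u = a *\<^sub>R u + b *\<^sub>R u"
    by transfer (auto simp: L2_rel_def distrib_right
        intro!: square_integrable_add square_integrable_scale)
  show "a *\<^sub>R b *\<^sub>R u = (a * b) *\<^sub>R u"
    by transfer (auto simp: L2_rel_def mult.assoc intro!: square_integrable_scale)
  show "1 *\<^sub>R u = u"
    by transfer (auto simp: L2_rel_def)
  show "dist u v = norm (u - v)" by (rule dist_L2_def)
  show "sgn u = inverse (norm u) *\<^sub>R u" by (rule sgn_L2_def)
  show "uniformity = (INF e\<in>{0 <..}. principal {(u, v :: 'a L2). dist u v < e})"
    by (rule uniformity_L2_def)
  show "open U = (\<forall>u\<in>U. eventually (\<lambda>(u', v). u' = u \<longrightarrow> v \<in> U) uniformity)"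
    for U :: "'a L2 set" by (rule open_L2_def)
  show "inner u v = inner v u"
    by transfer (simp add: mult.commute)
  show "inner (u + v) w = inner u w + inner v w"
    by transfer (simp add: L2_rel_def distrib_right square_integrable_prod)
  show "inner (a *\<^sub>R u) v = a * inner u v"
    by transfer (simp add: mult.assoc)
  show "0 \<le> inner u u"
    by transfer simp
  show "inner u u = 0 \<longleftrightarrow> u = 0"
  proof transfer
    fix f :: "'a \<Rightarrow> real"
    assume "L2_rel f f"
    then have f: "square_integrable f" by (simp add: L2_rel_def)
    have "integral\<^sup>L lebesgue (\<lambda>x. f x * f x) = 0 \<longleftrightarrow> (AE x in lebesgue. f x * f x = 0)"
      using square_integrable_prod[OF f f] by (intro integral_nonneg_eq_0_iff_AE) auto
    then show "integral\<^sup>L lebesgue (\<lambda>x. f x * f x) = 0 \<longleftrightarrow> L2_rel f (\<lambda>_. 0)"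
      using f by (simp add: L2_rel_def square_integrable_0)
  qed
  show "norm u = sqrt (inner u u)" by (rule norm_L2_def)
qed

end

text \<open>Functions on \<open>\<Omega>\<close> are identified with their extensions by zero.\<close>

definition L2_on :: "'a::euclidean_space set \<Rightarrow> 'a L2 set" where
  "L2_on \<Omega> = {u. AE x in lebesgue. x \<notin> \<Omega> \<longrightarrow> rep_L2 u x = 0}"

definition Linf_norm :: "'a::euclidean_space set \<Rightarrow> 'a L2 \<Rightarrow> ereal" where
  "Linf_norm \<Omega> u = esssup (lebesgue_on \<Omega>) (\<lambda>x. ereal \<bar>rep_L2 u x\<bar>)"

fun iter_partial :: "'a::euclidean_space list \<Rightarrow> ('a \<Rightarrow> real) \<Rightarrow> 'a \<Rightarrow> real" where
  "iter_partial [] f = f"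
| "iter_partial (b # bs) f = (\<lambda>x. frechet_derivative (iter_partial bs f) (at x) b)"

definition smooth_fun :: "('a::euclidean_space \<Rightarrow> real) \<Rightarrow> bool" where
  "smooth_fun f \<longleftrightarrow> (\<forall>bs x. set bs \<subseteq> Basis \<longrightarrow> iter_partial bs f differentiable (at x))"

definition supp :: "('a::topological_space \<Rightarrow> real) \<Rightarrow> 'a set" where
  "supp f = closure {x. f x \<noteq> 0}"

definition test_functions :: "'a::euclidean_space set \<Rightarrow> ('a \<Rightarrow> real) set" where
  "test_functions \<Omega> = {f. smooth_fun f \<and> compact (supp f) \<and> supp f \<subseteq> \<Omega>}"

definition has_weak_partial :: "'a::euclidean_space set \<Rightarrow> 'a \<Rightarrow> 'a L2 \<Rightarrow> 'a L2 \<Rightarrow> bool" where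
  "has_weak_partial \<Omega> b u g \<longleftrightarrow> g \<in> L2_on \<Omega> \<and>
     (\<forall>f\<in>test_functions \<Omega>. inner u (abs_L2 (iter_partial [b] f)) = - inner g (abs_L2 f))"

definition weak_partial :: "'a::euclidean_space set \<Rightarrow> 'a \<Rightarrow> 'a L2 \<Rightarrow> 'a L2" where
  "weak_partial \<Omega> b u = (THE g. has_weak_partial \<Omega> b u g)"

definition H1 :: "'a::euclidean_space set \<Rightarrow> 'a L2 set" where
  "H1 \<Omega> = {u \<in> L2_on \<Omega>. \<forall>b\<in>Basis. \<exists>g. has_weak_partial \<Omega> b u g}"

definition H1_norm :: "'a::euclidean_space set \<Rightarrow> 'a L2 \<Rightarrow> real" where
  "H1_norm \<Omega> u = sqrt ((norm u)\<^sup>2 + (\<Sum>b\<in>Basis. (norm (weak_partial \<Omega> b u))\<^sup>2))"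

definition H10 :: "'a::euclidean_space set \<Rightarrow> 'a L2 set" where
  "H10 \<Omega> = {u \<in> H1 \<Omega>. \<forall>e>0. \<exists>f\<in>test_functions \<Omega>. H1_norm \<Omega> (u - abs_L2 f) < e}"

text \<open>Operators between subspaces are total functions of which only the values on the
  domain subspace matter.\<close>

definition linear_on_subspace :: "'v::real_inner set \<Rightarrow> ('v \<Rightarrow> 'v) \<Rightarrow> bool" where
  "linear_on_subspace S A \<longleftrightarrow>
     (\<forall>u\<in>S. \<forall>v\<in>S. A (u + v) = A u + A v) \<and> (\<forall>c. \<forall>u\<in>S. A (c *\<^sub>R u) = c *\<^sub>R A u)"

definition bounded_ops :: "'v::real_inner set \<Rightarrow> 'v set \<Rightarrow> ('v \<Rightarrow> 'v) set" where
  "bounded_ops S R = {A. A ` S \<subseteq> R \<and> linear_on_subspace S A \<and>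
     (\<exists>c. \<forall>u\<in>S. norm (A u) \<le> c * norm u)}"

text \<open>The adjoint of \<open>A\<close>, an operator with domain \<open>S\<close>, takes its values in \<open>S\<close>.\<close>

definition adjoint_on :: "'v::real_inner set \<Rightarrow> ('v \<Rightarrow> 'v) \<Rightarrow> 'v \<Rightarrow> 'v" where
  "adjoint_on S A v = (THE w. w \<in> S \<and> (\<forall>u\<in>S. inner (A u) v = inner u w))"

definition orth_proj :: "'v::real_inner set \<Rightarrow> 'v \<Rightarrow> 'v" where
  "orth_proj S u = (THE p. p \<in> S \<and> (\<forall>v\<in>S. inner (u - p) v = 0))"

definition spd_on :: "'v::real_inner set \<Rightarrow> ('v \<Rightarrow> 'v) \<Rightarrow> bool" where
  "spd_on S A \<longleftrightarrow> A \<in> bounded_ops S S \<and>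
     (\<forall>u\<in>S. \<forall>v\<in>S. inner (A u) v = inner u (A v)) \<and> (\<forall>u\<in>S - {0}. inner (A u) u > 0)"

text \<open>Meaningful only for operators satisfying \<^const>\<open>spd_on\<close>; \<open>ennreal\<close> makes the
  supremum over an empty set equal to \<open>0\<close>.\<close>

definition spectral_dist ::
  "'v::real_inner set \<Rightarrow> ('v \<Rightarrow> 'v) \<Rightarrow> ('v \<Rightarrow> 'v) \<Rightarrow> ennreal" where
  "spectral_dist S A B = (SUP u\<in>S - {0}. ennreal \<bar>ln (inner (A u) u / inner (B u) u)\<bar>)"

definition polyhedral_domain :: "'a::euclidean_space set \<Rightarrow> bool" where
  "polyhedral_domain \<Omega> \<longleftrightarrow> open \<Omega> \<and> connected \<Omega> \<and> \<Omega> \<noteq> {} \<and> bounded \<Omega> \<and>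
     (\<exists>P. finite P \<and> (\<forall>F\<in>P. polytope F) \<and> frontier \<Omega> = \<Union>P)"

definition inball_diameter :: "'a::euclidean_space set \<Rightarrow> real" where
  "inball_diameter S = Sup {2 * r |r. \<exists>x. 0 \<le> r \<and> cball x r \<subseteq> S}"

text \<open>\<open>T k i\<close>, for \<open>i \<in> {1..N k}\<close>, is the \<open>i\<close>-th element of the triangulation of level \<open>k\<close>.\<close>

definition mesh_size :: "(int \<Rightarrow> nat \<Rightarrow> 'a::euclidean_space set) \<Rightarrow> (int \<Rightarrow> nat) \<Rightarrow> int \<Rightarrow> real" where
  "mesh_size T N k = Max ((\<lambda>i. diameter (T k i)) ` {1..N k})"

text \<open>Levels are integers \<open>k \<ge> -1\<close>. Level \<open>-1\<close> is only the triangulation used to define the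
  inactive domain one level below \<open>j\<^sub>0 = 0\<close>; taking it equal to level \<open>0\<close> is allowed, so its
  presence does not restrict the family of levels \<open>k \<ge> 0\<close>.\<close>

definition mesh_family ::
  "'a::euclidean_space set \<Rightarrow> (int \<Rightarrow> nat \<Rightarrow> 'a set) \<Rightarrow> (int \<Rightarrow> nat) \<Rightarrow> real \<Rightarrow> real \<Rightarrow> bool" where
  "mesh_family \<Omega> T N f_low f_high \<longleftrightarrow>
     (\<forall>k\<ge>-1. triangulation (T k ` {1..N k}) \<and> inj_on (T k) {1..N k} \<and>
        (\<forall>i\<in>{1..N k}. int DIM('a) simplex T k i) \<and> (\<Union>i\<in>{1..N k}. T k i) = closure \<Omega>) \<and>
     (\<forall>k\<ge>-1. \<forall>i\<in>{1..N (k + 1)}. \<exists>i'\<in>{1..N k}. T (k + 1) i \<subseteq> T k i') \<and>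
     (\<exists>\<sigma>. \<forall>k\<ge>0. \<forall>i\<in>{1..N k}. diameter (T k i) \<le> \<sigma> * inball_diameter (T k i)) \<and>
     0 < f_low \<and> f_low \<le> f_high \<and> f_high < 1 \<and>
     (\<forall>k\<ge>0. f_low \<le> mesh_size T N (k + 1) / mesh_size T N k \<and>
            mesh_size T N (k + 1) / mesh_size T N k \<le> f_high)"

definition phi :: "(int \<Rightarrow> nat \<Rightarrow> 'a::euclidean_space set) \<Rightarrow> int \<Rightarrow> nat \<Rightarrow> 'a \<Rightarrow> real" where
  "phi T k i = indicator (T k i)"

text \<open>\<open>pc_space T k I\<close> is the span of the basis functions of level \<open>k\<close> with index in \<open>I\<close>; the full
  space of piecewise constants is the case \<open>I = {1..N k}\<close>.\<close>

definition pc_space :: "(int \<Rightarrow> nat \<Rightarrow> 'a::euclidean_space set) \<Rightarrow> int \<Rightarrow> nat set \<Rightarrow> 'a L2 set" where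
  "pc_space T k I = span ((\<lambda>i. abs_L2 (phi T k i)) ` I)"

text \<open>The finite element spaces \<open>V k\<close> may be any finite-dimensional subspaces of \<open>L2_on \<Omega>\<close>.\<close>

definition operator_setting ::
  "'a::euclidean_space set \<Rightarrow> (int \<Rightarrow> nat \<Rightarrow> 'a set) \<Rightarrow> (int \<Rightarrow> nat) \<Rightarrow>
   ('a L2 \<Rightarrow> 'a L2) \<Rightarrow> (int \<Rightarrow> 'a L2 set) \<Rightarrow> (int \<Rightarrow> 'a L2 \<Rightarrow> 'a L2) \<Rightarrow> bool" where
  "operator_setting \<Omega> T N K V Kd \<longleftrightarrow>
     linear_on_subspace (L2_on \<Omega>) K \<and> K ` L2_on \<Omega> \<subseteq> H10 \<Omega> \<and>
     (\<exists>c. \<forall>u\<in>L2_on \<Omega>. H1_norm \<Omega> (K u) \<le> c * norm u) \<and>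
     (\<forall>k\<ge>0. (\<exists>B. finite B \<and> V k = span B) \<and> V k \<subseteq> L2_on \<Omega> \<and>
            Kd k \<in> bounded_ops (pc_space T k {1..N k}) (V k))"

definition SAC ::
  "'a::euclidean_space set \<Rightarrow> (int \<Rightarrow> nat \<Rightarrow> 'a set) \<Rightarrow> (int \<Rightarrow> nat) \<Rightarrow>
   ('a L2 \<Rightarrow> 'a L2) \<Rightarrow> (int \<Rightarrow> 'a L2 \<Rightarrow> 'a L2) \<Rightarrow> bool" where
  "SAC \<Omega> T N K Kd \<longleftrightarrow> (\<exists>C1.
     (\<forall>u\<in>L2_on \<Omega>. adjoint_on (L2_on \<Omega>) K u \<in> H1 \<Omega> \<and> K u \<in> H1 \<Omega> \<and>
        max (norm (adjoint_on (L2_on \<Omega>) K u)) (norm (K u)) \<le> C1 * norm u \<and>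
        max (H1_norm \<Omega> (adjoint_on (L2_on \<Omega>) K u)) (H1_norm \<Omega> (K u)) \<le> C1 * norm u) \<and>
     (\<forall>k\<ge>0. \<forall>u\<in>pc_space T k {1..N k}. norm (K u - Kd k u) \<le> C1 * mesh_size T N k * norm u) \<and>
     (\<forall>k\<ge>0. \<forall>u\<in>pc_space T k {1..N k}. Linf_norm \<Omega> (Kd k u) \<le> ereal (C1 * norm u)))"

definition inactive_dom :: "(int \<Rightarrow> nat \<Rightarrow> 'a::euclidean_space set) \<Rightarrow> int \<Rightarrow> nat set \<Rightarrow> 'a set" where
  "inactive_dom T k I = (\<Union>i\<in>I. supp (phi T k i))"

text \<open>\<open>coarsen_inactive T N j I m\<close> is the index set of level \<open>j - m\<close> generated from the index set
  \<open>I\<close> of level \<open>j\<close>.\<close>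

primrec coarsen_inactive ::
  "(int \<Rightarrow> nat \<Rightarrow> 'a::euclidean_space set) \<Rightarrow> (int \<Rightarrow> nat) \<Rightarrow> int \<Rightarrow> nat set \<Rightarrow> nat \<Rightarrow> nat set" where
  "coarsen_inactive T N j I 0 = I"
| "coarsen_inactive T N j I (Suc m) =
     {i \<in> {1..N (j - int (Suc m))}.
        measure lebesgue (supp (phi T (j - int (Suc m)) i) \<inter>
          inactive_dom T (j - int m) (coarsen_inactive T N j I m)) > 0}"

definition inactive ::
  "(int \<Rightarrow> nat \<Rightarrow> 'a::euclidean_space set) \<Rightarrow> (int \<Rightarrow> nat) \<Rightarrow> int \<Rightarrow> nat set \<Rightarrow> int \<Rightarrow> nat set" where
  "inactive T N j I k = coarsen_inactive T N j I (nat (j - k))"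

definition mu_jump ::
  "(int \<Rightarrow> nat \<Rightarrow> 'a::euclidean_space set) \<Rightarrow> (int \<Rightarrow> nat) \<Rightarrow> int \<Rightarrow> nat set \<Rightarrow> int \<Rightarrow> real" where
  "mu_jump T N j I k =
     measure lebesgue (inactive_dom T (k - 1) (inactive T N j I (k - 1)) -
                       inactive_dom T k (inactive T N j I k))"

text \<open>Extension operators between nested subspaces are inclusions and do not appear.\<close>

definition hessian ::
  "(int \<Rightarrow> nat \<Rightarrow> 'a::euclidean_space set) \<Rightarrow> (int \<Rightarrow> nat) \<Rightarrow> (int \<Rightarrow> 'a L2 \<Rightarrow> 'a L2) \<Rightarrow> real \<Rightarrow>
   int \<Rightarrow> nat set \<Rightarrow> 'a L2 \<Rightarrow> 'a L2" where
  "hessian T N Kd \<beta> k I u =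
     orth_proj (pc_space T k I)
       (adjoint_on (pc_space T k {1..N k}) (Kd k) (Kd k u) + \<beta> *\<^sub>R u)"

definition hessian_inv ::
  "(int \<Rightarrow> nat \<Rightarrow> 'a::euclidean_space set) \<Rightarrow> (int \<Rightarrow> nat) \<Rightarrow> (int \<Rightarrow> 'a L2 \<Rightarrow> 'a L2) \<Rightarrow> real \<Rightarrow>
   int \<Rightarrow> nat set \<Rightarrow> 'a L2 \<Rightarrow> 'a L2" where
  "hessian_inv T N Kd \<beta> k I = inv_into (pc_space T k I) (hessian T N Kd \<beta> k I)"

text \<open>\<open>I\<close> is the index set of level \<open>k\<close>, \<open>I'\<close> that of level \<open>k - 1\<close>.\<close>

definition interp ::
  "(int \<Rightarrow> nat \<Rightarrow> 'a::euclidean_space set) \<Rightarrow> real \<Rightarrow> int \<Rightarrow> nat set \<Rightarrow> nat set \<Rightarrow>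
   ('a L2 \<Rightarrow> 'a L2) \<Rightarrow> 'a L2 \<Rightarrow> 'a L2" where
  "interp T \<beta> k I I' X u =
     (let p = orth_proj (pc_space T (k - 1) I') u
      in orth_proj (pc_space T k I) (X p + inverse \<beta> *\<^sub>R (u - p)))"

definition newton ::
  "(int \<Rightarrow> nat \<Rightarrow> 'a::euclidean_space set) \<Rightarrow> (int \<Rightarrow> nat) \<Rightarrow> (int \<Rightarrow> 'a L2 \<Rightarrow> 'a L2) \<Rightarrow> real \<Rightarrow>
   int \<Rightarrow> nat set \<Rightarrow> ('a L2 \<Rightarrow> 'a L2) \<Rightarrow> 'a L2 \<Rightarrow> 'a L2" where
  "newton T N Kd \<beta> k I X u = 2 *\<^sub>R X u - X (hessian T N Kd \<beta> k I (X u))"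

text \<open>\<open>mg_inner \<dots> j I j\<^sub>0 m\<close> is \<open>\<Z>\<close> at level \<open>j\<^sub>0 + m\<close>, computed with a Newton step at
  each level above \<open>j\<^sub>0\<close>; \<open>mg_precond\<close> omits that step at the finest level \<open>j\<close>.\<close>

primrec mg_inner ::
  "(int \<Rightarrow> nat \<Rightarrow> 'a::euclidean_space set) \<Rightarrow> (int \<Rightarrow> nat) \<Rightarrow> (int \<Rightarrow> 'a L2 \<Rightarrow> 'a L2) \<Rightarrow> real \<Rightarrow>
   int \<Rightarrow> nat set \<Rightarrow> int \<Rightarrow> nat \<Rightarrow> 'a L2 \<Rightarrow> 'a L2" where
  "mg_inner T N Kd \<beta> j I j0 0 = hessian_inv T N Kd \<beta> j0 (inactive T N j I j0)"
| "mg_inner T N Kd \<beta> j I j0 (Suc m) =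
     (let k = j0 + int (Suc m)
      in newton T N Kd \<beta> k (inactive T N j I k)
           (interp T \<beta> k (inactive T N j I k) (inactive T N j I (k - 1))
             (mg_inner T N Kd \<beta> j I j0 m)))"

definition mg_precond ::
  "(int \<Rightarrow> nat \<Rightarrow> 'a::euclidean_space set) \<Rightarrow> (int \<Rightarrow> nat) \<Rightarrow> (int \<Rightarrow> 'a L2 \<Rightarrow> 'a L2) \<Rightarrow> real \<Rightarrow>
   int \<Rightarrow> nat set \<Rightarrow> int \<Rightarrow> 'a L2 \<Rightarrow> 'a L2" where
  "mg_precond T N Kd \<beta> j I j0 =
     interp T \<beta> j I (inactive T N j I (j - 1)) (mg_inner T N Kd \<beta> j I j0 (nat (j - 1 - j0)))"

text \<open>The estimate for one \<open>\<beta>\<close> and given constants. If it holds for \<open>C_tg\<close> it holds for every larger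
  constant; with \<open>C_tg * \<delta> \<ge> 1 / 10\<close>, its premise follows from
  \<open>C_tg * inverse \<beta> * (mesh_size T N k + mu_jump T N k I k) < 1 / 10\<close>.\<close>

definition two_grid_estimate ::
  "(int \<Rightarrow> nat \<Rightarrow> 'a::euclidean_space set) \<Rightarrow> (int \<Rightarrow> nat) \<Rightarrow> (int \<Rightarrow> 'a L2 \<Rightarrow> 'a L2) \<Rightarrow> real \<Rightarrow>
   real \<Rightarrow> real \<Rightarrow> bool" where
  "two_grid_estimate T N Kd \<beta> \<delta> C_tg \<longleftrightarrow>
     (\<forall>k\<ge>1. \<forall>I\<subseteq>{1..N k}. inverse \<beta> * (mesh_size T N k + mu_jump T N k I k) < \<delta> \<longrightarrow>
        spectral_dist (pc_space T k I)
          (interp T \<beta> k I (inactive T N k I (k - 1))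
            (hessian_inv T N Kd \<beta> (k - 1) (inactive T N k I (k - 1))))
          (hessian_inv T N Kd \<beta> k I)
        \<le> ennreal (C_tg * inverse \<beta> * (mesh_size T N k + mu_jump T N k I k)))"

end

theory Submission
  imports Defs
begin

text \<open>Write \<open>e k\<close> for the two-grid bound \<open>C_tg / \<beta> * (h k + \<mu> k)\<close> and \<open>d k\<close> for the spectral
  distance of \<open>\<Z> k\<close> to the inverse Hessian. Transferring an operator to the next finer level does
  not increase spectral distances, and a Newton step maps a distance \<open>d \<le> 1 / 5\<close> to at most
  \<open>2 * d\<^sup>2\<close>, so \<open>d k \<le> 2 * (d (k - 1) + e k)\<^sup>2\<close>. Since \<open>e k \<le> f / 8\<close> and \<open>f * e k \<le> e (k + 1)\<close>, the
  bound \<open>d (k - 1) \<le> e k\<close> gives \<open>d k \<le> 8 * (e k)\<^sup>2 \<le> e (k + 1)\<close>. Hence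
  \<open>d j \<le> d (j - 1) + e j \<le> 2 * e j\<close>.

  \<open>C_tg\<close> is taken at least \<open>1 / (10 * \<delta>)\<close>, so that the smallness hypothesis implies the premise of
  the two-grid estimate.\<close>

section \<open>Finite-dimensional subspaces: orthogonal projections and adjoints\<close>

text \<open>A finite spanning set is what Gram-Schmidt starts from; projections and adjoints then
  become explicit finite sums rather than consequences of completeness.\<close>

definition finite_dim :: "'v::real_inner set \<Rightarrow> bool" where
  "finite_dim S \<longleftrightarrow> (\<exists>B. finite B \<and> S = span B)"

text \<open>Spectral distance at most \<open>d\<close>, freed of logarithm and quotient, so that
  bounds can be chained and added and \<open>u = 0\<close> is no exception.\<close>

definition form_close :: "'v::real_inner set \<Rightarrow> real \<Rightarrow> ('v \<Rightarrow> 'v) \<Rightarrow> ('v \<Rightarrow> 'v) \<Rightarrow> bool" where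
  "form_close S d A B \<longleftrightarrow> (\<forall>u\<in>S. exp (- d) * inner (B u) u \<le> inner (A u) u \<and>
     inner (A u) u \<le> exp d * inner (B u) u)"

lemma finite_dim_span: "finite B \<Longrightarrow> finite_dim (span B)"
  by (auto simp: finite_dim_def)

lemma finite_dim_subspace: "finite_dim S \<Longrightarrow> subspace S"
  by (auto simp: finite_dim_def)

text \<open>Gram-Schmidt makes the spanning set orthogonal; the residual of the Fourier sum is then
  orthogonal to each generator, hence to the span.\<close>

lemma finite_dim_orthogonal_expansion:
  fixes S :: "'v::real_inner set"
  assumes "finite_dim S"
  obtains C where "finite C" "C \<subseteq> S"
    "\<And>u v. v \<in> S \<Longrightarrow> inner (u - (\<Sum>c\<in>C. (inner u c / inner c c) *\<^sub>R c)) v = 0"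
proof -
  obtain B where B: "finite B" "S = span B"
    using assms by (auto simp: finite_dim_def)
  obtain C where C: "finite C" "span C = span B" "pairwise orthogonal C"
    using basis_orthogonal[OF B(1)] by blast
  have "inner (u - (\<Sum>c\<in>C. (inner u c / inner c c) *\<^sub>R c)) v = 0" if "v \<in> span C" for u v
    using that
  proof (induction rule: span_induct_alt)
    case base
    then show ?case by simp
  next
    case (step a x y)
    have "inner (\<Sum>c\<in>C. (inner u c / inner c c) *\<^sub>R c) x
        = (\<Sum>c\<in>C. if c = x then inner u x else 0)"
      unfolding inner_sum_left
    proof (rule sum.cong[OF refl])
      fix c assume "c \<in> C"
      \<comment> \<open>\<open>C\<close> may contain zero: the quotient is then 0 by convention and
        both sides vanish.\<close>
      then show "inner ((inner u c / inner c c) *\<^sub>R c) x = (if c = x then inner u x else 0)"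
        using C(3) step(1) by (auto simp: pairwise_def orthogonal_def)
    qed
    also have "\<dots> = inner u x"
      using C(1) step(1) by simp
    finally show ?case
      using step(2) by (simp add: inner_add_right inner_diff_left)
  qed
  moreover have "C \<subseteq> S"
    using C(2) B(2) span_superset[of C] by simp
  ultimately show ?thesis
    using that C(1,2) B(2) by auto
qed

text \<open>Gives the definite description in \<open>orth_proj\<close> its meaning: the difference
  of two candidates lies in \<open>S\<close> and is orthogonal to itself.\<close>

lemma orth_proj_unique_existence:
  assumes "finite_dim S"
  shows "\<exists>!p. p \<in> S \<and> (\<forall>v\<in>S. inner (u - p) v = 0)"
proof -
  obtain C where C: "finite C" "C \<subseteq> S"
    "\<And>u v. v \<in> S \<Longrightarrow> inner (u - (\<Sum>c\<in>C. (inner u c / inner c c) *\<^sub>R c)) v = 0"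
    using finite_dim_orthogonal_expansion[OF assms] by blast
  have S: "subspace S"
    using assms by (rule finite_dim_subspace)
  show ?thesis
  proof (rule ex_ex1I)
    have "(\<Sum>c\<in>C. (inner u c / inner c c) *\<^sub>R c) \<in> S"
      using C(2) S by (auto intro!: subspace_sum subspace_scale)
    then show "\<exists>p. p \<in> S \<and> (\<forall>v\<in>S. inner (u - p) v = 0)"
      using C(3) by blast
  next
    fix p q
    assume p: "p \<in> S \<and> (\<forall>v\<in>S. inner (u - p) v = 0)" and q: "q \<in> S \<and> (\<forall>v\<in>S. inner (u - q) v = 0)"
    have "p - q \<in> S"
      using p q S by (simp add: subspace_diff)
    then have "inner (u - p) (p - q) = 0" "inner (u - q) (p - q) = 0"
      using p q by blast+
    then have "inner (p - q) (p - q) = 0"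
      by (simp add: inner_diff_left)
    then show "p = q" by simp
  qed
qed

lemma
  assumes "finite_dim S"
  shows orth_proj_in: "orth_proj S u \<in> S"
    and inner_orth_proj: "v \<in> S \<Longrightarrow> inner (orth_proj S u) v = inner u v"
  using theI'[OF orth_proj_unique_existence[OF assms, of u]]
  unfolding orth_proj_def[symmetric] by (auto simp: inner_diff_left)

text \<open>Equations in \<open>S\<close> are proved weakly, by testing against \<open>S\<close>;
  the decisive test vector is the difference of the two sides.\<close>

lemma eq_on_subspaceI:
  assumes "subspace S" "x \<in> S" "y \<in> S" "\<And>v. v \<in> S \<Longrightarrow> inner x v = inner y v"
  shows "x = y"
proof -
  have "x - y \<in> S"
    using assms by (simp add: subspace_diff)
  then have "inner (x - y) (x - y) = 0"
    using assms(4)[of "x - y"] by (simp add: inner_diff_left)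
  then show ?thesis by simp
qed

lemma finite_dim_expansion:
  fixes S :: "'v::real_inner set"
  assumes "finite_dim S"
  obtains C where "finite C" "C \<subseteq> S"
    "\<And>u. u \<in> S \<Longrightarrow> u = (\<Sum>c\<in>C. (inner u c / inner c c) *\<^sub>R c)"
proof -
  obtain C where C: "finite C" "C \<subseteq> S"
    "\<And>u v. v \<in> S \<Longrightarrow> inner (u - (\<Sum>c\<in>C. (inner u c / inner c c) *\<^sub>R c)) v = 0"
    using finite_dim_orthogonal_expansion[OF assms] by blast
  have S: "subspace S"
    using assms by (rule finite_dim_subspace)
  have "u = (\<Sum>c\<in>C. (inner u c / inner c c) *\<^sub>R c)" if "u \<in> S" for u
  proof (rule eq_on_subspaceI[OF S that])
    show "(\<Sum>c\<in>C. (inner u c / inner c c) *\<^sub>R c) \<in> S"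
      using C(2) S by (auto intro!: subspace_sum subspace_scale)
    show "inner u v = inner (\<Sum>c\<in>C. (inner u c / inner c c) *\<^sub>R c) v" if "v \<in> S" for v
      using C(3)[OF that, of u] by (simp only: inner_diff_left right_minus_eq)
  qed
  then show ?thesis
    using that C(1,2) by blast
qed

lemma linear_on_subspace_sum:
  assumes "linear_on_subspace S A" "subspace S" "finite C" "C \<subseteq> S"
  shows "A (\<Sum>c\<in>C. a c *\<^sub>R c) = (\<Sum>c\<in>C. a c *\<^sub>R A c)"
  using assms(3,4)
proof (induction rule: finite_induct)
  case empty
  have "A (0 *\<^sub>R 0) = 0 *\<^sub>R A 0"
    using assms(1,2) subspace_0 unfolding linear_on_subspace_def by blast
  then show ?case by simp
next
  case (insert x F)
  have "(\<Sum>c\<in>F. a c *\<^sub>R c) \<in> S" "a x *\<^sub>R x \<in> S"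
    using insert.prems assms(2) by (auto intro!: subspace_sum subspace_scale)
  then show ?case
    using insert assms(1) by (simp add: linear_on_subspace_def)
qed

lemma
  fixes A :: "'v::real_inner \<Rightarrow> 'v"
  assumes "finite_dim S" "linear_on_subspace S A"
  shows adjoint_on_in: "adjoint_on S A v \<in> S"
    and inner_adjoint_on: "u \<in> S \<Longrightarrow> inner u (adjoint_on S A v) = inner (A u) v"
proof -
  obtain C where C: "finite C" "C \<subseteq> S"
    "\<And>u. u \<in> S \<Longrightarrow> u = (\<Sum>c\<in>C. (inner u c / inner c c) *\<^sub>R c)"
    using finite_dim_expansion[OF assms(1)] by blast
  have S: "subspace S"
    using assms(1) by (rule finite_dim_subspace)
  have "\<exists>!w. w \<in> S \<and> (\<forall>u\<in>S. inner (A u) v = inner u w)"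
  proof (rule ex_ex1I)
    \<comment> \<open>The Riesz representative of the functional sending \<open>u\<close> to
      \<open>inner (A u) v\<close>, read off from its values on the expansion vectors
      \<open>C\<close>.\<close>
    let ?w = "\<Sum>c\<in>C. (inner (A c) v / inner c c) *\<^sub>R c"
    have "?w \<in> S"
      using C(2) S by (auto intro!: subspace_sum subspace_scale)
    moreover have "inner (A u) v = inner u ?w" if "u \<in> S" for u
    proof -
      have "A u = (\<Sum>c\<in>C. (inner u c / inner c c) *\<^sub>R A c)"
        using linear_on_subspace_sum[OF assms(2) S C(1,2), of "\<lambda>c. inner u c / inner c c"]
          C(3)[OF that] by simp
      then show ?thesis
        by (simp add: inner_sum_left inner_sum_right mult.commute)
    qed
    ultimately show "\<exists>w. w \<in> S \<and> (\<forall>u\<in>S. inner (A u) v = inner u w)" by blast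
  next
    fix w w'
    assume "w \<in> S \<and> (\<forall>u\<in>S. inner (A u) v = inner u w)" "w' \<in> S \<and> (\<forall>u\<in>S. inner (A u) v = inner u w')"
    then show "w = w'"
      by (intro eq_on_subspaceI[OF S]) (auto simp: inner_commute)
  qed
  from theI'[OF this] show "adjoint_on S A v \<in> S"
    and "u \<in> S \<Longrightarrow> inner u (adjoint_on S A v) = inner (A u) v"
    unfolding adjoint_on_def[symmetric] by auto
qed

section \<open>Symmetric positive definite operators on a subspace and their inverses\<close>

text \<open>Symmetry forces linearity, since \<open>A (u + v)\<close> and \<open>A u + A v\<close>
  have equal inner products with all of \<open>S\<close>; boundedness then follows from the finite
  expansion.\<close>

lemma spd_onI:
  fixes A :: "'v::real_inner \<Rightarrow> 'v"
  assumes "finite_dim S"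
    and maps: "\<And>u. u \<in> S \<Longrightarrow> A u \<in> S"
    and sym: "\<And>u v. u \<in> S \<Longrightarrow> v \<in> S \<Longrightarrow> inner (A u) v = inner u (A v)"
    and pos: "\<And>u. u \<in> S \<Longrightarrow> u \<noteq> 0 \<Longrightarrow> inner (A u) u > 0"
  shows "spd_on S A"
proof -
  have S: "subspace S"
    using assms(1) by (rule finite_dim_subspace)
  have "A (u + v) = A u + A v" if "u \<in> S" "v \<in> S" for u v
    by (rule eq_on_subspaceI[OF S])
      (use that S in \<open>simp_all add: maps sym subspace_add inner_add_left\<close>)
  moreover have "A (c *\<^sub>R u) = c *\<^sub>R A u" if "u \<in> S" for u c
    by (rule eq_on_subspaceI[OF S]) (use that S in \<open>simp_all add: maps sym subspace_scale\<close>)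
  ultimately have lin: "linear_on_subspace S A"
    by (simp add: linear_on_subspace_def)
  obtain C where C: "finite C" "C \<subseteq> S"
    "\<And>u. u \<in> S \<Longrightarrow> u = (\<Sum>c\<in>C. (inner u c / inner c c) *\<^sub>R c)"
    using finite_dim_expansion[OF assms(1)] by blast
  \<comment> \<open>Triangle inequality on the expansion of \<open>A u\<close>, with Cauchy-Schwarz
    for each coefficient.\<close>
  have "norm (A u) \<le> (\<Sum>c\<in>C. norm c / inner c c * norm (A c)) * norm u" if "u \<in> S" for u
  proof -
    have "A u = (\<Sum>c\<in>C. (inner u c / inner c c) *\<^sub>R A c)"
      using linear_on_subspace_sum[OF lin S C(1,2), of "\<lambda>c. inner u c / inner c c"]
        C(3)[OF that] by simp
    then have "norm (A u) \<le> (\<Sum>c\<in>C. norm ((inner u c / inner c c) *\<^sub>R A c))"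
      by (simp only: norm_sum)
    also have "\<dots> \<le> (\<Sum>c\<in>C. norm c / inner c c * norm (A c) * norm u)"
    proof (rule sum_mono)
      fix c
      have "\<bar>inner u c\<bar> / inner c c \<le> norm u * norm c / inner c c"
        by (intro divide_right_mono Cauchy_Schwarz_ineq2) simp
      then have "\<bar>inner u c\<bar> / inner c c * norm (A c) \<le> norm u * norm c / inner c c * norm (A c)"
        by (rule mult_right_mono) simp
      then show "norm ((inner u c / inner c c) *\<^sub>R A c) \<le> norm c / inner c c * norm (A c) * norm u"
        by (simp add: ac_simps)
    qed
    finally show ?thesis
      by (simp add: sum_distrib_right)
  qed
  then have "A \<in> bounded_ops S S"
    using lin maps by (auto simp: bounded_ops_def)
  then show ?thesis
    using sym pos by (auto simp: spd_on_def)
qed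

lemma
  assumes "spd_on S A"
  shows spd_on_in: "u \<in> S \<Longrightarrow> A u \<in> S"
    and spd_on_sym: "u \<in> S \<Longrightarrow> v \<in> S \<Longrightarrow> inner (A u) v = inner u (A v)"
    and spd_on_pos: "u \<in> S \<Longrightarrow> u \<noteq> 0 \<Longrightarrow> inner (A u) u > 0"
    and spd_on_linear: "linear_on_subspace S A"
  using assms by (auto simp: spd_on_def bounded_ops_def)

lemma spd_on_nonneg: "spd_on S A \<Longrightarrow> u \<in> S \<Longrightarrow> inner (A u) u \<ge> 0"
  by (cases "u = 0") (auto dest: spd_on_pos[of S A u])

lemma
  assumes "spd_on S A" "subspace S"
  shows spd_on_add: "u \<in> S \<Longrightarrow> v \<in> S \<Longrightarrow> A (u + v) = A u + A v"
    and spd_on_scale: "u \<in> S \<Longrightarrow> A (c *\<^sub>R u) = c *\<^sub>R A u"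
    and spd_on_diff: "u \<in> S \<Longrightarrow> v \<in> S \<Longrightarrow> A (u - v) = A u - A v"
proof -
  show add: "A (u + v) = A u + A v" if "u \<in> S" "v \<in> S" for u v
    using spd_on_linear[OF assms(1)] that by (simp add: linear_on_subspace_def)
  show scale: "A (c *\<^sub>R u) = c *\<^sub>R A u" if "u \<in> S" for u c
    using spd_on_linear[OF assms(1)] that by (simp add: linear_on_subspace_def)
  show "A (u - v) = A u - A v" if "u \<in> S" "v \<in> S"
    using add[OF that(1), of "(-1) *\<^sub>R v"] scale[OF that(2), of "-1"] that(2) assms(2)
    by (simp add: subspace_neg)
qed

text \<open>Surjectivity needs no dimension count: a vector of \<open>S\<close> orthogonal to the range of a
  positive definite operator is orthogonal to its own image, hence zero.\<close>

lemma spd_on_bij: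
  assumes "spd_on S A" "finite_dim S"
  shows "bij_betw A S S"
proof -
  have S: "subspace S"
    using assms(2) by (rule finite_dim_subspace)
  have "inj_on A S"
  proof (rule inj_onI)
    fix u v assume uv: "u \<in> S" "v \<in> S" "A u = A v"
    then have "inner (A (u - v)) (u - v) = 0"
      by (simp add: spd_on_diff[OF assms(1) S])
    then show "u = v"
      using spd_on_pos[OF assms(1), of "u - v"] uv S by (force simp: subspace_diff)
  qed
  moreover have "A ` S = S"
  proof
    show "A ` S \<subseteq> S"
      using spd_on_in[OF assms(1)] by auto
    obtain C where C: "finite C" "C \<subseteq> S"
      "\<And>u. u \<in> S \<Longrightarrow> u = (\<Sum>c\<in>C. (inner u c / inner c c) *\<^sub>R c)"
      using finite_dim_expansion[OF assms(2)] by blast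
    \<comment> \<open>The projection needs a space known to be finite-dimensional: the span of the
      images of \<open>C\<close> is one, and it contains every \<open>A u\<close>.\<close>
    define R where "R = span (A ` C)"
    have R: "finite_dim R"
      using C(1) by (simp add: R_def finite_dim_span)
    have AR: "A u \<in> R" if "u \<in> S" for u
    proof -
      have "A u = (\<Sum>c\<in>C. (inner u c / inner c c) *\<^sub>R A c)"
        using linear_on_subspace_sum[OF spd_on_linear[OF assms(1)] S C(1,2),
            of "\<lambda>c. inner u c / inner c c"] C(3)[OF that] by simp
      also have "\<dots> \<in> R"
        by (auto simp: R_def intro!: span_sum span_scale intro: span_base)
      finally show ?thesis .
    qed
    have "subspace (A ` S)"
      unfolding subspace_def
    proof (intro conjI ballI allI)
      have "A 0 = 0"
        using spd_on_scale[OF assms(1) S subspace_0[OF S], of 0] by simp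
      then show "0 \<in> A ` S"
        using subspace_0[OF S] by force
    next
      fix x y assume "x \<in> A ` S" "y \<in> A ` S"
      then show "x + y \<in> A ` S"
        using subspace_add[OF S] by (auto simp flip: spd_on_add[OF assms(1) S])
    next
      fix c x assume "x \<in> A ` S"
      then show "c *\<^sub>R x \<in> A ` S"
        using subspace_scale[OF S] by (auto simp flip: spd_on_scale[OF assms(1) S])
    qed
    then have RS: "R \<subseteq> A ` S"
      unfolding R_def using C(2) by (intro span_minimal) auto
    show "S \<subseteq> A ` S"
    proof
      fix v assume v: "v \<in> S"
      define r where "r = v - orth_proj R v"
      have "orth_proj R v \<in> S"
        using orth_proj_in[OF R, of v] RS \<open>A ` S \<subseteq> S\<close> by blast
      then have r: "r \<in> S"
        using v S by (simp add: r_def subspace_diff)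
      have "inner (A r) r = 0"
        using inner_orth_proj[OF R AR[OF r], of v]
        by (simp add: r_def inner_diff_left inner_commute)
      then have "r = 0"
        using spd_on_pos[OF assms(1) r] by force
      then show "v \<in> A ` S"
        using orth_proj_in[OF R, of v] RS by (auto simp: r_def)
    qed
  qed
  ultimately show ?thesis
    by (simp add: bij_betw_def)
qed

lemma
  assumes "spd_on S A" "finite_dim S"
  shows spd_on_inv_into: "spd_on S (inv_into S A)"
    and spd_on_apply_inv: "u \<in> S \<Longrightarrow> A (inv_into S A u) = u"
    and spd_on_inv_apply: "u \<in> S \<Longrightarrow> inv_into S A (A u) = u"
proof -
  note bij = spd_on_bij[OF assms]
  show ap: "A (inv_into S A u) = u" if "u \<in> S" for u
    using bij that by (rule bij_betw_inv_into_right)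
  show "inv_into S A (A u) = u" if "u \<in> S" for u
    using bij that by (rule bij_betw_inv_into_left)
  have maps: "inv_into S A u \<in> S" if "u \<in> S" for u
    using bij that by (metis bij_betw_imp_surj_on inv_into_into)
  show "spd_on S (inv_into S A)"
  proof (rule spd_onI[OF assms(2) maps])
    fix u v assume uv: "u \<in> S" "v \<in> S"
    show "inner (inv_into S A u) v = inner u (inv_into S A v)"
      using spd_on_sym[OF assms(1) maps[OF uv(1)] maps[OF uv(2)]] uv by (simp add: ap)
  next
    fix u assume u: "u \<in> S" "u \<noteq> 0"
    \<comment> \<open>With \<open>w\<close> the preimage of \<open>u\<close> this is
      \<open>inner w (A w)\<close>; \<open>w = 0\<close> is impossible because
      \<open>A 0 = 0\<close>.\<close>
    show "inner (inv_into S A u) u > 0"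
    proof (cases "inv_into S A u = 0")
      case True
      then have "A 0 = u" using ap[OF u(1)] by simp
      moreover have "A 0 = 0"
        using spd_on_scale[OF assms(1) finite_dim_subspace[OF assms(2)], of 0 0]
          finite_dim_subspace[OF assms(2)] by (simp add: subspace_0)
      ultimately show ?thesis using u by simp
    next
      case False
      then show ?thesis
        using spd_on_pos[OF assms(1) maps[OF u(1)]] ap[OF u(1)] by (simp add: inner_commute)
    qed
  qed
qed

section \<open>The spectral distance as a two-sided comparison of quadratic forms\<close>

text \<open>Exponentiating removes the logarithm, and positivity of the form of \<open>B\<close>
  removes the quotient. For \<open>0 \<le> d\<close> the embedding \<open>ennreal d\<close> does not
  truncate.\<close>

lemma spectral_dist_le_iff_form_close:
  assumes A: "spd_on S A" and B: "spd_on S B" and d: "0 \<le> d"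
  shows "spectral_dist S A B \<le> ennreal d \<longleftrightarrow> form_close S d A B"
proof -
  have "\<bar>ln (inner (A u) u / inner (B u) u)\<bar> \<le> d \<longleftrightarrow>
      exp (- d) * inner (B u) u \<le> inner (A u) u \<and> inner (A u) u \<le> exp d * inner (B u) u"
    if "u \<in> S - {0}" for u
  proof -
    have a: "inner (A u) u > 0" and b: "inner (B u) u > 0"
      using spd_on_pos[OF A] spd_on_pos[OF B] that by auto
    let ?q = "inner (A u) u / inner (B u) u"
    have q: "?q > 0" using a b by simp
    have "\<bar>ln ?q\<bar> \<le> d \<longleftrightarrow> - d \<le> ln ?q \<and> ln ?q \<le> d" by linarith
    also have "\<dots> \<longleftrightarrow> exp (- d) \<le> ?q \<and> ?q \<le> exp d"
      using q ln_ge_iff[OF q] ln_le_cancel_iff[OF q, of "exp d"] by simp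
    also have "\<dots> \<longleftrightarrow> exp (- d) * inner (B u) u \<le> inner (A u) u \<and> inner (A u) u \<le> exp d * inner (B u) u"
      using b by (simp add: le_divide_eq divide_le_eq)
    finally show ?thesis .
  qed
  moreover have "exp (- d) * inner (B u) u \<le> inner (A u) u \<and> inner (A u) u \<le> exp d * inner (B u) u"
    if "u = 0" for u
    using that by simp
  ultimately show ?thesis
    using d by (auto simp: spectral_dist_def form_close_def SUP_le_iff ennreal_le_iff)
qed

text \<open>The triangle inequality of the spectral distance in multiplicative form.\<close>

lemma form_close_trans:
  assumes "form_close S d A B" "form_close S e B C"
  shows "form_close S (d + e) A C"
  unfolding form_close_def
proof (intro ballI conjI)
  fix u assume u: "u \<in> S"
  have "exp (- d) * (exp (- e) * inner (C u) u) \<le> exp (- d) * inner (B u) u"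
    using assms(2) u by (simp add: form_close_def)
  also have "\<dots> \<le> inner (A u) u"
    using assms(1) u by (simp add: form_close_def)
  finally show "exp (- (d + e)) * inner (C u) u \<le> inner (A u) u"
    by (simp add: exp_add[symmetric] mult.assoc[symmetric])
  have "inner (A u) u \<le> exp d * inner (B u) u"
    using assms(1) u by (simp add: form_close_def)
  also have "\<dots> \<le> exp d * (exp e * inner (C u) u)"
    using assms(2) u by (simp add: form_close_def)
  finally show "inner (A u) u \<le> exp (d + e) * inner (C u) u"
    by (simp add: exp_add mult.assoc)
qed

lemma form_close_mono:
  assumes "form_close S d A B" "d \<le> e" "spd_on S B"
  shows "form_close S e A B"
  unfolding form_close_def
proof (intro ballI conjI)
  fix u assume u: "u \<in> S"
  have b: "inner (B u) u \<ge> 0"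
    using spd_on_nonneg[OF assms(3) u] .
  have "exp (- e) * inner (B u) u \<le> exp (- d) * inner (B u) u"
    using b assms(2) by (intro mult_right_mono) auto
  also have "\<dots> \<le> inner (A u) u"
    using assms(1) u by (simp add: form_close_def)
  finally show "exp (- e) * inner (B u) u \<le> inner (A u) u" .
  have "inner (A u) u \<le> exp d * inner (B u) u"
    using assms(1) u by (simp add: form_close_def)
  also have "\<dots> \<le> exp e * inner (B u) u"
    using b assms(2) by (intro mult_right_mono) auto
  finally show "inner (A u) u \<le> exp e * inner (B u) u" .
qed

lemma form_close_zero: "spd_on S A \<Longrightarrow> 0 \<le> d \<Longrightarrow> form_close S d A A"
  by (rule form_close_mono[of S 0]) (auto simp: form_close_def)

section \<open>Quadratic contraction of the Newton step\<close>

text \<open>The scalar core of the contraction: \<open>exp d - 1\<close> bounds the relative error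
  before the step, its square the relative loss after it. The threshold gives
  \<open>d\<^sup>2 \<le> d / 5\<close>, hence \<open>exp d - 1 \<le> 6 / 5 * d\<close>.\<close>

lemma newton_scalar_bound:
  fixes d :: real
  assumes "0 \<le> d" "d \<le> 1 / 5"
  shows "exp (- (2 * d\<^sup>2)) \<le> 1 - (exp d - 1)\<^sup>2"
proof -
  have dd: "d\<^sup>2 \<le> d / 5"
    using mult_left_mono[OF assms(2,1)] by (simp add: power2_eq_square)
  have "exp d \<le> 1 + d + d\<^sup>2"
    using assms by (intro exp_bound) auto
  then have "exp d - 1 \<le> 6 / 5 * d"
    using dd by linarith
  moreover have "0 \<le> exp d - 1"
    using assms by simp
  ultimately have "(exp d - 1)\<^sup>2 \<le> (6 / 5 * d)\<^sup>2"
    by (intro power_mono)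
  then have 1: "(exp d - 1)\<^sup>2 \<le> 36 / 25 * d\<^sup>2"
    by (simp add: power_mult_distrib power_divide)
  define x where "x = d\<^sup>2"
  have x: "0 \<le> x" "x \<le> 1 / 25"
    using dd assms by (auto simp: x_def)
  have xx: "x * x \<le> x / 25"
    using mult_left_mono[OF x(2,1)] by simp
  \<comment> \<open>The product exceeds 1 by \<open>14 / 25 * x - 72 / 25 * (x * x)\<close>, which
    is nonnegative for such small \<open>x\<close>.\<close>
  have "1 \<le> (1 - 36 / 25 * x) * (1 + 2 * x)"
    using x xx by (simp add: algebra_simps)
  also have "\<dots> \<le> (1 - 36 / 25 * x) * exp (2 * x)"
    using x by (intro mult_left_mono) auto
  finally have "exp (- (2 * x)) \<le> 1 - 36 / 25 * x"
    by (simp add: exp_minus inverse_eq_divide divide_le_eq)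
  then show ?thesis
    using 1 by (simp add: x_def)
qed

text \<open>With \<open>D = X - H\<inverse>\<close> one has \<open>H\<inverse> - (2 X - X H X) = D H D\<close>. Polarization turns the bound on
  the form of \<open>D\<close> relative to that of \<open>H\<inverse>\<close> into one for \<open>\<langle>D u, H D u\<rangle>\<close>.\<close>

lemma newton_close:
  fixes S :: "'v::real_inner set"
  assumes fd: "finite_dim S" and H: "spd_on S H" and X: "spd_on S X"
    and close: "form_close S d X (inv_into S H)" and d: "0 \<le> d" "d \<le> 1 / 5"
  defines "Y \<equiv> \<lambda>u. 2 *\<^sub>R X u - X (H (X u))"
  shows "spd_on S Y" "form_close S (2 * d\<^sup>2) Y (inv_into S H)"
proof -
  define G where "G = inv_into S H"
  have S: "subspace S"
    using fd by (rule finite_dim_subspace)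
  have G: "spd_on S G"
    using H fd unfolding G_def by (rule spd_on_inv_into)
  have HG: "H (G u) = u" "G (H u) = u" if "u \<in> S" for u
    using spd_on_apply_inv[OF H fd that] spd_on_inv_apply[OF H fd that] by (auto simp: G_def)
  note mem = spd_on_in[OF H] spd_on_in[OF X] spd_on_in[OF G]
  define D where "D u = X u - G u" for u
  define \<epsilon> where "\<epsilon> = exp d - 1"
  have eps: "0 \<le> \<epsilon>" using d by (simp add: \<epsilon>_def)
  \<comment> \<open>The error from below, \<open>1 - exp (- d)\<close>, is at most \<open>d\<close>,
    which is at most \<open>exp d - 1\<close>: one \<open>\<epsilon>\<close> serves for both
    sides.\<close>
  have "1 + d \<le> exp d" "1 - d \<le> exp (- d)"
    using exp_ge_add_one_self[of d] exp_ge_add_one_self[of "-d"] by simp_all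
  then have em: "1 - exp (- d) \<le> \<epsilon>" unfolding \<epsilon>_def by linarith
  have Dmem: "D u \<in> S" if "u \<in> S" for u
    using that by (simp add: D_def mem S subspace_diff)
  have Dsym: "inner (D u) v = inner u (D v)" if "u \<in> S" "v \<in> S" for u v
    using spd_on_sym[OF X that] spd_on_sym[OF G that]
    by (simp add: D_def inner_diff_left inner_diff_right)
  have Dadd: "D (u + v) = D u + D v" "D (u - v) = D u - D v" "D (c *\<^sub>R u) = c *\<^sub>R D u"
    if "u \<in> S" "v \<in> S" for u v c
    using that
    by (simp_all add: D_def spd_on_add[OF X S] spd_on_add[OF G S] spd_on_diff[OF X S]
        spd_on_diff[OF G S] spd_on_scale[OF X S] spd_on_scale[OF G S] scaleR_diff_right)
  have Dform: "\<bar>inner (D u) u\<bar> \<le> \<epsilon> * inner (G u) u" if "u \<in> S" for u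
  proof -
    have g: "inner (G u) u \<ge> 0"
      using spd_on_nonneg[OF G that] .
    have "exp (- d) * inner (G u) u \<le> inner (X u) u" "inner (X u) u \<le> exp d * inner (G u) u"
      using close that by (auto simp: form_close_def G_def)
    moreover have "(1 - exp (- d)) * inner (G u) u \<le> \<epsilon> * inner (G u) u"
      using em g by (rule mult_right_mono)
    ultimately show ?thesis
      by (simp add: D_def \<epsilon>_def inner_diff_left left_diff_distrib abs_le_iff)
  qed
  have key: "inner (D u) (H (D u)) \<le> \<epsilon>\<^sup>2 * inner (G u) u" if u: "u \<in> S" for u
  proof -
    define v where "v = H (D u)"
    define s where "s = inner (D u) v"
    have v: "v \<in> S" using u by (simp add: v_def mem Dmem)
    \<comment> \<open>Polarization and the parallelogram law for the pair
      \<open>t *\<^sub>R u\<close>, \<open>v\<close>. The choice \<open>v = H (D u)\<close> makes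
      \<open>inner (G v) v\<close> equal to \<open>s\<close> again, so the inequality closes on
      \<open>s\<close>.\<close>
    have pol: "2 * t * s \<le> \<epsilon> * (t\<^sup>2 * inner (G u) u + s)" for t
    proof -
      have tu: "t *\<^sub>R u \<in> S" using u S by (simp add: subspace_scale)
      have "4 * inner (D (t *\<^sub>R u)) v
          = inner (D (t *\<^sub>R u + v)) (t *\<^sub>R u + v) - inner (D (t *\<^sub>R u - v)) (t *\<^sub>R u - v)"
        using tu v Dsym[OF tu v]
        by (simp add: Dadd inner_add_left inner_add_right inner_diff_left inner_diff_right
            inner_commute)
      also have "\<dots> \<le> \<epsilon> * inner (G (t *\<^sub>R u + v)) (t *\<^sub>R u + v)
          + \<epsilon> * inner (G (t *\<^sub>R u - v)) (t *\<^sub>R u - v)"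
        using Dform[of "t *\<^sub>R u + v"] Dform[of "t *\<^sub>R u - v"] tu v S
        by (simp add: subspace_add subspace_diff abs_le_iff)
      also have "\<dots> = 2 * \<epsilon> * (inner (G (t *\<^sub>R u)) (t *\<^sub>R u) + inner (G v) v)"
        using tu v
        by (simp add: spd_on_add[OF G S] spd_on_diff[OF G S] inner_add_left inner_add_right
            inner_diff_left inner_diff_right algebra_simps)
      also have "inner (G v) v = s"
        using HG(2)[OF Dmem[OF u]] by (simp add: v_def s_def)
      finally show ?thesis
        using u v by (simp add: Dadd spd_on_scale[OF G S] s_def power2_eq_square mult.assoc)
    qed
    have "s \<le> \<epsilon>\<^sup>2 * inner (G u) u"
    \<comment> \<open>The weight \<open>t = \<epsilon>\<close> gives the sharp bound after
      cancelling one factor \<open>\<epsilon>\<close>; when that factor is zero,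
      \<open>t = 1\<close> already gives \<open>s \<le> 0\<close>.\<close>
    proof (cases "\<epsilon> = 0")
      case True
      then show ?thesis using pol[of 1] by simp
    next
      case False
      then have "\<epsilon> > 0" using eps by simp
      moreover have "\<epsilon> * (2 * s) \<le> \<epsilon> * (\<epsilon>\<^sup>2 * inner (G u) u + s)"
        using pol[of \<epsilon>] by (simp add: ac_simps)
      ultimately have "2 * s \<le> \<epsilon>\<^sup>2 * inner (G u) u + s"
        by (simp only: mult_le_cancel_left_pos)
      then show ?thesis by simp
    qed
    then show ?thesis by (simp add: s_def v_def)
  qed
  have Yform: "inner (Y u) u = inner (G u) u - inner (D u) (H (D u))" if u: "u \<in> S" for u
  proof -
    have "H (D u) = H (X u) - u"
      using u by (simp add: D_def spd_on_diff[OF H S] mem HG)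
    moreover have "inner (X (H (X u))) u = inner (H (X u)) (X u)"
      using spd_on_sym[OF X _ u] u by (simp add: mem)
    moreover have "inner (G u) (H (X u)) = inner u (X u)"
      using spd_on_sym[OF H, of "G u" "X u"] u by (simp add: mem HG)
    ultimately show ?thesis
      by (simp add: Y_def D_def inner_diff_left inner_diff_right inner_commute)
  qed
  \<comment> \<open>Used twice: for positivity of \<open>Y\<close> and as the lower half of the
    comparison.\<close>
  have low: "exp (- (2 * d\<^sup>2)) * inner (G u) u \<le> inner (Y u) u" if u: "u \<in> S" for u
  proof -
    have "exp (- (2 * d\<^sup>2)) * inner (G u) u \<le> (1 - \<epsilon>\<^sup>2) * inner (G u) u"
      unfolding \<epsilon>_def using newton_scalar_bound[OF d] spd_on_nonneg[OF G u]
      by (rule mult_right_mono)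
    then show ?thesis
      using key[OF u] Yform[OF u] by (simp add: left_diff_distrib)
  qed
  show "spd_on S Y"
  proof (rule spd_onI[OF fd])
    show "Y u \<in> S" if "u \<in> S" for u
      using that S by (simp add: Y_def mem subspace_diff subspace_scale)
    show "inner (Y u) v = inner u (Y v)" if uv: "u \<in> S" "v \<in> S" for u v
      using spd_on_sym[OF X uv] spd_on_sym[OF X _ uv(2), of "H (X u)"]
        spd_on_sym[OF H, of "X u" "X v"] spd_on_sym[OF X uv(1), of "H (X v)"] uv
      by (simp add: Y_def mem inner_diff_left inner_diff_right)
    show "inner (Y u) u > 0" if "u \<in> S" "u \<noteq> 0" for u
      using low[OF that(1)] spd_on_pos[OF G that]
      by (smt (verit) exp_gt_zero mult_pos_pos)
  qed
  \<comment> \<open>The correction \<open>D H D\<close> is nonnegative, so the Newton iterate never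
    exceeds the inverse and the upper half holds even with factor 1.\<close>
  have "inner (Y u) u \<le> exp (2 * d\<^sup>2) * inner (G u) u" if u: "u \<in> S" for u
  proof -
    have "inner (D u) (H (D u)) \<ge> 0"
      using spd_on_nonneg[OF H Dmem[OF u]] by (simp add: inner_commute)
    then have "inner (Y u) u \<le> 1 * inner (G u) u"
      using Yform[OF u] by simp
    also have "\<dots> \<le> exp (2 * d\<^sup>2) * inner (G u) u"
      using spd_on_nonneg[OF G u] by (intro mult_right_mono) auto
    finally show ?thesis .
  qed
  then show "form_close S (2 * d\<^sup>2) Y (inv_into S H)"
    using low unfolding form_close_def G_def by blast
qed

section \<open>The Hessians on the inactive spaces\<close>

lemma finite_dim_pc_space: "finite I \<Longrightarrow> finite_dim (pc_space T k I)"
  by (simp add: pc_space_def finite_dim_span)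

text \<open>Tested against \<open>v\<close> in the inactive space the projection drops out;
  \<open>v\<close> also lies in the full space of level \<open>k\<close>, where the adjoint can be
  moved onto it.\<close>

lemma inner_hessian:
  assumes Kd: "Kd k \<in> bounded_ops (pc_space T k {1..N k}) W" and I: "I \<subseteq> {1..N k}"
    and u: "u \<in> pc_space T k I" and v: "v \<in> pc_space T k I"
  shows "inner (hessian T N Kd \<beta> k I u) v = inner (Kd k u) (Kd k v) + \<beta> * inner u v"
proof -
  have fin: "finite I" using I finite_subset by blast
  have "pc_space T k I \<subseteq> pc_space T k {1..N k}"
    unfolding pc_space_def using I by (intro span_mono image_mono)
  then have v': "v \<in> pc_space T k {1..N k}" using v by blast
  have lin: "linear_on_subspace (pc_space T k {1..N k}) (Kd k)"
    using Kd by (simp add: bounded_ops_def)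
  show ?thesis
    unfolding hessian_def inner_orth_proj[OF finite_dim_pc_space[OF fin] v] inner_add_left
    using inner_adjoint_on[OF finite_dim_pc_space lin v', of "Kd k u"]
    by (simp add: inner_commute)
qed

lemma spd_on_hessian:
  assumes Kd: "Kd k \<in> bounded_ops (pc_space T k {1..N k}) W" and I: "I \<subseteq> {1..N k}" and "\<beta> > 0"
  shows "spd_on (pc_space T k I) (hessian T N Kd \<beta> k I)"
proof (rule spd_onI)
  show fd: "finite_dim (pc_space T k I)"
    using I finite_subset by (blast intro: finite_dim_pc_space)
  show "hessian T N Kd \<beta> k I u \<in> pc_space T k I" for u
    unfolding hessian_def by (rule orth_proj_in[OF fd])
next
  note form = inner_hessian[of Kd k T N W, OF Kd I]
  fix u v assume uv: "u \<in> pc_space T k I" "v \<in> pc_space T k I"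
  show "inner (hessian T N Kd \<beta> k I u) v = inner u (hessian T N Kd \<beta> k I v)"
    using form[OF uv, of \<beta>] form[OF uv(2,1), of \<beta>] by (simp add: inner_commute)
next
  fix u assume u: "u \<in> pc_space T k I" "u \<noteq> 0"
  then show "inner (hessian T N Kd \<beta> k I u) u > 0"
    using inner_hessian[of Kd k T N W, OF Kd I u(1) u(1), of \<beta>] \<open>\<beta> > 0\<close> by (simp add: add_nonneg_pos)
qed

lemma spd_on_hessian_inv:
  assumes "Kd k \<in> bounded_ops (pc_space T k {1..N k}) W" "I \<subseteq> {1..N k}" "\<beta> > 0"
  shows "spd_on (pc_space T k I) (hessian_inv T N Kd \<beta> k I)"
  unfolding hessian_inv_def
  using assms finite_subset by (blast intro: spd_on_inv_into spd_on_hessian finite_dim_pc_space)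

section \<open>Transfer of operators to the next finer level\<close>

context
  fixes T :: "int \<Rightarrow> nat \<Rightarrow> 'a::euclidean_space set" and k :: int and I I' :: "nat set" and \<beta> :: real
  assumes fin: "finite I" "finite I'" and beta: "\<beta> > 0"
begin

text \<open>The form splits into a coarse block and a multiple of the identity on the complement:
  both cross terms vanish because residuals of \<open>P\<close> are orthogonal to the coarse
  space.\<close>

lemma inner_interp:
  assumes X: "spd_on (pc_space T (k - 1) I') X" and v: "v \<in> pc_space T k I"
  defines "P \<equiv> orth_proj (pc_space T (k - 1) I')"
  shows "inner (interp T \<beta> k I I' X u) v
    = inner (X (P u)) (P v) + inverse \<beta> * inner (u - P u) (v - P v)"
proof -
  note fd = finite_dim_pc_space[OF fin(1), of T k] and fd' = finite_dim_pc_space[OF fin(2), of T "k - 1"]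
  have "inner (X (P u)) v = inner (X (P u)) (P v)"
    using inner_orth_proj[OF fd' spd_on_in[OF X orth_proj_in[OF fd', of u]], of v]
    by (simp add: P_def inner_commute)
  moreover have "inner (u - P u) (P v) = 0"
    using inner_orth_proj[OF fd' orth_proj_in[OF fd', of v], of u]
    by (simp add: P_def inner_diff_left)
  ultimately show ?thesis
    using inner_orth_proj[OF fd v]
    by (simp add: interp_def Let_def P_def[symmetric] inner_add_left inner_diff_right)
qed

lemma spd_on_interp:
  assumes X: "spd_on (pc_space T (k - 1) I') X"
  shows "spd_on (pc_space T k I) (interp T \<beta> k I I' X)"
proof (rule spd_onI)
  let ?P = "orth_proj (pc_space T (k - 1) I')"
  show fd: "finite_dim (pc_space T k I)"
    by (rule finite_dim_pc_space[OF fin(1)])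
  have P: "?P u \<in> pc_space T (k - 1) I'" for u
    by (rule orth_proj_in[OF finite_dim_pc_space[OF fin(2)]])
  show "interp T \<beta> k I I' X u \<in> pc_space T k I" for u
    by (simp add: interp_def Let_def orth_proj_in[OF fd])
  show "inner (interp T \<beta> k I I' X u) v = inner u (interp T \<beta> k I I' X v)"
    if "u \<in> pc_space T k I" "v \<in> pc_space T k I" for u v
    using inner_interp[OF X that(1), of v] inner_interp[OF X that(2), of u]
      spd_on_sym[OF X P P, of u v]
    by (simp add: inner_commute)
  show "inner (interp T \<beta> k I I' X u) u > 0" if u: "u \<in> pc_space T k I" "u \<noteq> 0" for u
  \<comment> \<open>One block is always strictly positive: if the coarse component vanishes, the
    complement is \<open>u\<close> itself.\<close>
  proof (cases "?P u = 0")
    case True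
    have "X 0 = 0"
      using spd_on_scale[OF X finite_dim_subspace, of 0 0] P[of u] True fin(2)
      by (simp add: finite_dim_pc_space)
    then show ?thesis
      using inner_interp[OF X u(1), of u] True u beta by simp
  next
    case False
    then show ?thesis
      using inner_interp[OF X u(1), of u] spd_on_pos[OF X P False] beta
      by (simp add: add_pos_nonneg)
  qed
qed

text \<open>The complement blocks of the two transferred operators coincide, so only the coarse
  blocks differ and the same \<open>d\<close> bounds the sum.\<close>

lemma interp_close:
  assumes X: "spd_on (pc_space T (k - 1) I') X" and Y: "spd_on (pc_space T (k - 1) I') Y"
    and close: "form_close (pc_space T (k - 1) I') d X Y" and d: "0 \<le> d"
  shows "form_close (pc_space T k I) d (interp T \<beta> k I I' X) (interp T \<beta> k I I' Y)"
  unfolding form_close_def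
proof (intro ballI)
  let ?P = "orth_proj (pc_space T (k - 1) I')"
  fix u assume u: "u \<in> pc_space T k I"
  have P: "?P u \<in> pc_space T (k - 1) I'"
    by (rule orth_proj_in[OF finite_dim_pc_space[OF fin(2)]])
  define r where "r = inverse \<beta> * inner (u - ?P u) (u - ?P u)"
  have "r \<ge> 0" using beta by (simp add: r_def)
  then have "exp (- d) * r \<le> r" "r \<le> exp d * r"
    using d mult_right_mono[of "exp (- d)" 1 r] mult_right_mono[of 1 "exp d" r] by auto
  moreover have "exp (- d) * inner (Y (?P u)) (?P u) \<le> inner (X (?P u)) (?P u)"
    "inner (X (?P u)) (?P u) \<le> exp d * inner (Y (?P u)) (?P u)"
    using close P by (auto simp: form_close_def)
  ultimately show "exp (- d) * inner (interp T \<beta> k I I' Y u) u \<le> inner (interp T \<beta> k I I' X u) u \<and>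
      inner (interp T \<beta> k I I' X u) u \<le> exp d * inner (interp T \<beta> k I I' Y u) u"
    unfolding inner_interp[OF X u] inner_interp[OF Y u] r_def[symmetric]
    by (simp add: distrib_left)
qed

end

section \<open>Mesh sizes and generated inactive sets\<close>

lemma mesh_size_pos:
  assumes "polyhedral_domain \<Omega>" "mesh_family \<Omega> T N f_low f_high" "0 \<le> k"
  shows "mesh_size T N k > 0"
proof -
  have cover: "(\<Union>i\<in>{1..N k}. T k i) = closure \<Omega>"
    and simplex: "\<And>i. i \<in> {1..N k} \<Longrightarrow> int DIM('a) simplex T k i"
    using assms(2,3) by (auto simp: mesh_family_def)
  have "closure \<Omega> \<noteq> {}"
    using assms(1) by (simp add: polyhedral_domain_def)
  then obtain i where i: "i \<in> {1..N k}"
    unfolding cover[symmetric] by blast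
  have "0 \<le> diameter (T k i)"
    using simplex[OF i] by (intro diameter_ge_0 polytope_imp_bounded simplex_imp_polytope)
  also have "\<dots> \<le> mesh_size T N k"
    unfolding mesh_size_def using i by (intro Max_ge) auto
  finally have "0 \<le> mesh_size T N k" .
  \<comment> \<open>If the mesh size were zero, the quotient would be 0 by convention and fall below
    \<open>f_low\<close>.\<close>
  moreover have "0 < f_low" "f_low \<le> mesh_size T N (k + 1) / mesh_size T N k"
    using assms(2,3) by (auto simp: mesh_family_def)
  then have "mesh_size T N k \<noteq> 0" by auto
  ultimately show ?thesis by simp
qed

lemma mesh_size_step:
  assumes "polyhedral_domain \<Omega>" "mesh_family \<Omega> T N f_low f_high" "0 \<le> k"
  shows "mesh_size T N (k + 1) \<le> mesh_size T N k"
    and "f_low * mesh_size T N k \<le> mesh_size T N (k + 1)"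
proof -
  have "f_low \<le> mesh_size T N (k + 1) / mesh_size T N k"
    "mesh_size T N (k + 1) / mesh_size T N k \<le> f_high" "f_high < 1"
    using assms(2,3) by (auto simp: mesh_family_def)
  then have "f_low \<le> mesh_size T N (k + 1) / mesh_size T N k"
    "mesh_size T N (k + 1) / mesh_size T N k \<le> 1" by auto
  then show "mesh_size T N (k + 1) \<le> mesh_size T N k"
    and "f_low * mesh_size T N k \<le> mesh_size T N (k + 1)"
    using mesh_size_pos[OF assms] by (simp_all add: pos_le_divide_eq pos_divide_le_eq)
qed

lemma inactive_top [simp]: "inactive T N k I k = I"
  by (simp add: inactive_def)

lemma inactive_subset:
  assumes "I \<subseteq> {1..N j}" "k \<le> j"
  shows "inactive T N j I k \<subseteq> {1..N k}"
proof (cases "nat (j - k)")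
  case 0
  then show ?thesis using assms by (simp add: inactive_def)
next
  case (Suc m)
  then have "j - int (Suc m) = k" by linarith
  then show ?thesis by (auto simp: inactive_def Suc simp del: of_nat_Suc)
qed

text \<open>The two-grid estimate restarts the coarsening at level \<open>k\<close>. Each coarsening
  step sees only the next finer index set, so the restarted chain agrees with the one from level
  \<open>j\<close>.\<close>

lemma inactive_pred:
  assumes "k \<le> j"
  shows "inactive T N k (inactive T N j I k) (k - 1) = inactive T N j I (k - 1)"
proof -
  have eq: "nat (j - (k - 1)) = Suc (nat (j - k))" "nat (k - (k - 1)) = Suc 0"
    "j - int (Suc (nat (j - k))) = k - 1" "j - int (nat (j - k)) = k"
    using assms by auto
  show ?thesis
    unfolding inactive_def eq(1,2) coarsen_inactive.simps eq(3,4) by simp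
qed

lemma mu_jump_inactive:
  "k \<le> j \<Longrightarrow> mu_jump T N k (inactive T N j I k) k = mu_jump T N j I k"
  by (simp add: mu_jump_def inactive_pred)

section \<open>Induction over the levels of the multigrid recursion\<close>

text \<open>The invariant bounds the error at level \<open>k\<close> by the two-grid error \<open>e (k + 1)\<close> of the next
  level, not by \<open>e k\<close>: the error of the last, Newton-free step is then at most \<open>2 * e j\<close>,
  uniformly in \<open>f\<close>.\<close>

lemma mg_precond_close:
  fixes e :: "int \<Rightarrow> real"
  assumes Kd: "\<And>k. 0 \<le> k \<Longrightarrow> Kd k \<in> bounded_ops (pc_space T k {1..N k}) (V k)"
    and beta: "\<beta> > 0" and j: "0 \<le> j0" "j0 < j" and I: "I \<subseteq> {1..N j}"
    and two_grid: "\<And>k. j0 < k \<Longrightarrow> k \<le> j \<Longrightarrow>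
      form_close (pc_space T k (inactive T N j I k))
        (e k)
        (interp T \<beta> k (inactive T N j I k) (inactive T N j I (k - 1))
          (hessian_inv T N Kd \<beta> (k - 1) (inactive T N j I (k - 1))))
        (hessian_inv T N Kd \<beta> k (inactive T N j I k))"
    and e_nonneg: "\<And>k. j0 < k \<Longrightarrow> k \<le> j \<Longrightarrow> 0 \<le> e k"
    and e_small: "\<And>k. j0 < k \<Longrightarrow> k \<le> j \<Longrightarrow> e k \<le> 1 / 10"
    and e_step: "\<And>k. j0 < k \<Longrightarrow> k < j \<Longrightarrow> 8 * (e k)\<^sup>2 \<le> e (k + 1)"
  shows "spd_on (pc_space T j I) (mg_precond T N Kd \<beta> j I j0)"
    and "form_close (pc_space T j I) (2 * e j) (mg_precond T N Kd \<beta> j I j0)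
      (hessian_inv T N Kd \<beta> j I)"
proof -
  let ?I = "inactive T N j I"
  let ?S = "\<lambda>k. pc_space T k (?I k)"
  let ?H = "\<lambda>k. hessian T N Kd \<beta> k (?I k)"
  let ?G = "\<lambda>k. hessian_inv T N Kd \<beta> k (?I k)"
  let ?Z = "mg_inner T N Kd \<beta> j I j0"
  have sub: "?I k \<subseteq> {1..N k}" if "k \<le> j" for k
    using I that by (rule inactive_subset)
  have fin: "finite (?I k)" if "k \<le> j" for k
    using sub[OF that] finite_subset by blast
  have G: "spd_on (?S k) (?G k)" if "0 \<le> k" "k \<le> j" for k
    using Kd[OF that(1)] sub[OF that(2)] beta by (rule spd_on_hessian_inv)
  \<comment> \<open>The coarse error \<open>e k\<close> passes through the transfer unchanged and
    the two-grid estimate adds a second \<open>e k\<close>. This serves both the induction and the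
    final level.\<close>
  have step: "spd_on (?S k) (interp T \<beta> k (?I k) (?I (k - 1)) X)"
    "form_close (?S k) (2 * e k) (interp T \<beta> k (?I k) (?I (k - 1)) X) (?G k)"
    if k: "j0 < k" "k \<le> j" and X: "spd_on (?S (k - 1)) X"
      and close: "form_close (?S (k - 1)) (e k) X (?G (k - 1))" for k X
  proof -
    have finI: "finite (?I k)" "finite (?I (k - 1))"
      using k by (auto intro: fin)
    show "spd_on (?S k) (interp T \<beta> k (?I k) (?I (k - 1)) X)"
      by (rule spd_on_interp[OF finI beta X])
    have "spd_on (?S (k - 1)) (?G (k - 1))"
      using k j by (intro G) auto
    from interp_close[OF finI beta X this close e_nonneg[OF k]]
    have "form_close (?S k) (e k) (interp T \<beta> k (?I k) (?I (k - 1)) X)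
        (interp T \<beta> k (?I k) (?I (k - 1)) (?G (k - 1)))" .
    from form_close_trans[OF this two_grid[OF k]]
    show "form_close (?S k) (2 * e k) (interp T \<beta> k (?I k) (?I (k - 1)) X) (?G k)"
      by simp
  qed
  \<comment> \<open>Staying strictly below \<open>j\<close> keeps the index
    \<open>j0 + int m + 1\<close> within the levels where \<open>e\<close> is controlled.\<close>
  have inner: "spd_on (?S (j0 + int m)) (?Z m) \<and>
      form_close (?S (j0 + int m)) (e (j0 + int m + 1)) (?Z m) (?G (j0 + int m))"
    if "j0 + int m < j" for m
    using that
  proof (induction m)
    case 0
    \<comment> \<open>The recursion starts from the exact inverse, whose error is zero.\<close>
    have "spd_on (?S j0) (?G j0)"
      using j by (intro G) auto
    then show ?case
      using form_close_zero[OF _ e_nonneg[of "j0 + 1"]] j by simp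
  next
    case (Suc m)
    define k where "k = j0 + int (Suc m)"
    have k: "j0 < k" "k < j" "j0 + int m = k - 1" "j0 + int m + 1 = k"
      using Suc.prems by (auto simp: k_def)
    let ?X = "interp T \<beta> k (?I k) (?I (k - 1)) (?Z m)"
    have IH: "spd_on (?S (k - 1)) (?Z m)" "form_close (?S (k - 1)) (e k) (?Z m) (?G (k - 1))"
      using Suc.IH k unfolding k(3) by auto
    note X = step[OF k(1) less_imp_le[OF k(2)] IH]
    have fd: "finite_dim (?S k)"
      using fin k(2) by (intro finite_dim_pc_space) auto
    have H: "spd_on (?S k) (?H k)"
      using Kd[of k] sub[of k] k j beta by (intro spd_on_hessian) auto
    \<comment> \<open>The bound \<open>1 / 10\<close> on \<open>e k\<close> is what puts the doubled
      error in the range \<open>1 / 5\<close> of the Newton estimate.\<close>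
    have "0 \<le> 2 * e k" "2 * e k \<le> 1 / 5"
      using e_nonneg[of k] e_small[of k] k by auto
    note newton = newton_close[OF fd H X(1) X(2)[unfolded hessian_inv_def] this]
    have Z: "?Z (Suc m) = (\<lambda>u. 2 *\<^sub>R ?X u - ?X (?H k (?X u)))"
      by (simp add: newton_def Let_def k_def fun_eq_iff del: of_nat_Suc)
    have spd: "spd_on (?S k) (?Z (Suc m))"
      unfolding Z by (rule newton(1))
    have "form_close (?S k) (e (k + 1)) (?Z (Suc m)) (?G k)"
    proof (rule form_close_mono)
      show "form_close (?S k) (2 * (2 * e k)\<^sup>2) (?Z (Suc m)) (?G k)"
        unfolding Z hessian_inv_def by (rule newton(2))
      show "2 * (2 * e k)\<^sup>2 \<le> e (k + 1)"
        using e_step[OF k(1,2)] by (simp add: power_mult_distrib)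
      show "spd_on (?S k) (?G k)"
        using k j by (intro G) auto
    qed
    with spd show ?case
      by (simp only: k_def)
  qed
  \<comment> \<open>The invariant at level \<open>j - 1\<close> already speaks of
    \<open>e j\<close>; one transfer without a Newton step doubles it. For \<open>j = j0 + 1\<close>
    this is the two-grid operator itself.\<close>
  have "j0 + int (nat (j - 1 - j0)) = j - 1"
    using j by simp
  with inner[of "nat (j - 1 - j0)"]
  have "spd_on (?S (j - 1)) (?Z (nat (j - 1 - j0)))"
    "form_close (?S (j - 1)) (e j) (?Z (nat (j - 1 - j0))) (?G (j - 1))"
    by auto
  from step[OF j(2) order_refl this]
  show "spd_on (pc_space T j I) (mg_precond T N Kd \<beta> j I j0)"
    and "form_close (pc_space T j I) (2 * e j) (mg_precond T N Kd \<beta> j I j0)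
      (hessian_inv T N Kd \<beta> j I)"
    by (simp_all add: mg_precond_def)
qed

section \<open>Uniform constants and the hypotheses of the level induction\<close>

theorem theorem4p6:
  fixes \<Omega> :: "'a::euclidean_space set"
    and T :: "int \<Rightarrow> nat \<Rightarrow> 'a set" and N :: "int \<Rightarrow> nat" and f_low f_high :: real
    and K :: "'a L2 \<Rightarrow> 'a L2" and V :: "int \<Rightarrow> 'a L2 set" and Kd :: "int \<Rightarrow> 'a L2 \<Rightarrow> 'a L2"
    and B :: "real set"
  assumes "polyhedral_domain \<Omega>"
    and "mesh_family \<Omega> T N f_low f_high"
    and "operator_setting \<Omega> T N K V Kd"
    and "SAC \<Omega> T N K Kd"
    and "\<forall>\<beta>\<in>B. \<beta> > 0"
    and "\<exists>\<delta>>0. \<exists>C_tg>0. \<forall>\<beta>\<in>B. two_grid_estimate T N Kd \<beta> \<delta> C_tg"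
  shows "\<exists>\<delta>>0. \<exists>C_tg>0. (\<forall>\<beta>\<in>B. two_grid_estimate T N Kd \<beta> \<delta> C_tg) \<and>
    (\<exists>C_mg>0. \<forall>\<beta>\<in>B. \<forall>(j0::int) (j::int) (I::nat set) (f::real).
       0 \<le> j0 \<and> j0 < j \<and> I \<subseteq> {1..N j} \<and> 0 < f \<and> f \<le> f_low \<and>
       (\<forall>k\<in>{j0 + 1..j}. mu_jump T N j I k \<le> mu_jump T N j I (k - 1) \<and>
                         mu_jump T N j I (k - 1) \<le> inverse f * mu_jump T N j I k) \<and>
       C_tg * inverse \<beta> * (mesh_size T N j0 + mu_jump T N j I j0) < min (1 / 10) (f / 8)
       \<longrightarrow> spd_on (pc_space T j I) (mg_precond T N Kd \<beta> j I j0) \<and>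
           spectral_dist (pc_space T j I) (mg_precond T N Kd \<beta> j I j0) (hessian_inv T N Kd \<beta> j I)
             \<le> ennreal (C_mg * inverse \<beta> * (mesh_size T N j + mu_jump T N j I j)))"
proof -
  obtain \<delta> C0 where \<delta>: "\<delta> > 0" and C0: "C0 > 0"
    and est0: "\<forall>\<beta>\<in>B. two_grid_estimate T N Kd \<beta> \<delta> C0"
    using assms(6) by blast
  define C where "C = max C0 (1 / (10 * \<delta>))"
  have C: "C > 0" "C0 \<le> C" "1 / 10 \<le> C * \<delta>"
  proof -
    show "C > 0" "C0 \<le> C" using C0 by (auto simp: C_def)
    have "1 / (10 * \<delta>) \<le> C" by (simp add: C_def)
    then show "1 / 10 \<le> C * \<delta>" using \<delta> by (simp add: field_simps)
  qed
  note mesh_pos = mesh_size_pos[OF assms(1,2)]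
  \<comment> \<open>Enlarging the constant keeps the estimate valid because the factor it multiplies
    is nonnegative.\<close>
  have est: "two_grid_estimate T N Kd \<beta> \<delta> C" if b: "\<beta> \<in> B" for \<beta>
    unfolding two_grid_estimate_def
  proof (intro allI impI)
    fix k :: int and I
    assume k: "1 \<le> k" and I: "I \<subseteq> {1..N k}"
      and small: "inverse \<beta> * (mesh_size T N k + mu_jump T N k I k) < \<delta>"
    have "\<beta> > 0" using assms(5) b by blast
    moreover have "0 \<le> mu_jump T N k I k" by (simp add: mu_jump_def)
    ultimately have "0 \<le> inverse \<beta> * (mesh_size T N k + mu_jump T N k I k)"
      using mesh_pos[of k] k by simp
    then have "C0 * (inverse \<beta> * (mesh_size T N k + mu_jump T N k I k))
        \<le> C * (inverse \<beta> * (mesh_size T N k + mu_jump T N k I k))"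
      using C(2) by (rule mult_right_mono[rotated])
    then have "ennreal (C0 * inverse \<beta> * (mesh_size T N k + mu_jump T N k I k))
        \<le> ennreal (C * inverse \<beta> * (mesh_size T N k + mu_jump T N k I k))"
      by (intro ennreal_leI) (simp add: mult.assoc)
    moreover have "spectral_dist (pc_space T k I)
          (interp T \<beta> k I (inactive T N k I (k - 1))
            (hessian_inv T N Kd \<beta> (k - 1) (inactive T N k I (k - 1))))
          (hessian_inv T N Kd \<beta> k I)
        \<le> ennreal (C0 * inverse \<beta> * (mesh_size T N k + mu_jump T N k I k))"
      using est0 b k I small unfolding two_grid_estimate_def by blast
    ultimately show "spectral_dist (pc_space T k I)
          (interp T \<beta> k I (inactive T N k I (k - 1))
            (hessian_inv T N Kd \<beta> (k - 1) (inactive T N k I (k - 1))))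
          (hessian_inv T N Kd \<beta> k I)
        \<le> ennreal (C * inverse \<beta> * (mesh_size T N k + mu_jump T N k I k))"
      by (rule order_trans[rotated])
  qed
  have Kd: "Kd k \<in> bounded_ops (pc_space T k {1..N k}) (V k)" if "0 \<le> k" for k
    using assms(3) that by (simp add: operator_setting_def)
  \<comment> \<open>The resulting constant \<open>2 * C\<close> is fixed before
    \<open>\<beta>\<close>, the levels, the index set and \<open>f\<close> are chosen.\<close>
  have main: "spd_on (pc_space T j I) (mg_precond T N Kd \<beta> j I j0) \<and>
      spectral_dist (pc_space T j I) (mg_precond T N Kd \<beta> j I j0) (hessian_inv T N Kd \<beta> j I)
        \<le> ennreal (2 * C * inverse \<beta> * (mesh_size T N j + mu_jump T N j I j))"
    if b: "\<beta> \<in> B" and j: "0 \<le> j0" "j0 < j" and I: "I \<subseteq> {1..N j}" and f: "0 < f" "f \<le> f_low"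
      and mu: "\<forall>k\<in>{j0 + 1..j}. mu_jump T N j I k \<le> mu_jump T N j I (k - 1) \<and>
                         mu_jump T N j I (k - 1) \<le> inverse f * mu_jump T N j I k"
      and small: "C * inverse \<beta> * (mesh_size T N j0 + mu_jump T N j I j0) < min (1 / 10) (f / 8)"
    for \<beta> j0 j I f
  proof -
    have beta: "\<beta> > 0" using assms(5) b by blast
    define g where "g k = mesh_size T N k + mu_jump T N j I k" for k
    define e where "e k = C * inverse \<beta> * g k" for k
    have c: "C * inverse \<beta> > 0" using C(1) beta by simp
    have g_nonneg: "0 \<le> g k" if "0 \<le> k" for k
      using mesh_pos[OF that] by (simp add: g_def mu_jump_def)
    \<comment> \<open>The mesh part decreases at most by \<open>f_low\<close>, hence at most by
      \<open>f\<close>; the jump part does so by hypothesis, applied at level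
      \<open>k + 1\<close>.\<close>
    have g_step: "g (k + 1) \<le> g k" "f * g k \<le> g (k + 1)" if k: "j0 \<le> k" "k < j" for k
    proof -
      have "0 \<le> k" using k j by simp
      note h = mesh_size_step[OF assms(1,2) this] and hp = mesh_pos[OF this]
      have m: "mu_jump T N j I (k + 1) \<le> mu_jump T N j I k"
        "mu_jump T N j I k \<le> inverse f * mu_jump T N j I (k + 1)"
        using mu[rule_format, of "k + 1"] k by auto
      show "g (k + 1) \<le> g k"
        using h m by (simp add: g_def)
      have "f * mu_jump T N j I k \<le> mu_jump T N j I (k + 1)"
        using m(2) f(1) by (simp add: field_simps)
      moreover have "f * mesh_size T N k \<le> mesh_size T N (k + 1)"
        using h(2) mult_right_mono[OF f(2) less_imp_le[OF hp]] by linarith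
      ultimately show "f * g k \<le> g (k + 1)"
        by (simp add: g_def distrib_left)
    qed
    have e_nonneg: "0 \<le> e k" if "0 \<le> k" for k
      using g_nonneg[OF that] c by (simp add: e_def)
    have e_mono: "e (k + 1) \<le> e k" "f * e k \<le> e (k + 1)" if k: "j0 \<le> k" "k < j" for k
    proof -
      show "e (k + 1) \<le> e k"
        unfolding e_def using g_step(1)[OF k] c by (intro mult_left_mono) auto
      have "C * inverse \<beta> * (f * g k) \<le> C * inverse \<beta> * g (k + 1)"
        using g_step(2)[OF k] c by (intro mult_left_mono) auto
      then show "f * e k \<le> e (k + 1)"
        by (simp add: e_def ac_simps)
    qed
    \<comment> \<open>Monotonicity carries the smallness assumed at \<open>j0\<close> to all finer
      levels.\<close>
    have e_less: "e k < min (1 / 10) (f / 8)" if "j0 \<le> k" "k \<le> j" for k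
      using that
    proof (induction rule: int_ge_induct)
      case base
      then show ?case using small by (simp add: e_def g_def)
    next
      case (step i)
      then have "e (i + 1) \<le> e i" by (intro e_mono(1)) auto
      also have "\<dots> < min (1 / 10) (f / 8)" using step by simp
      finally show ?case .
    qed
    let ?I = "inactive T N j I"
    have sub: "?I k \<subseteq> {1..N k}" if "k \<le> j" for k
      using I that by (rule inactive_subset)
    have fin: "finite (?I k)" if "k \<le> j" for k
      using sub[OF that] finite_subset by blast
    have tg: "form_close (pc_space T k (?I k)) (e k)
        (interp T \<beta> k (?I k) (?I (k - 1)) (hessian_inv T N Kd \<beta> (k - 1) (?I (k - 1))))
        (hessian_inv T N Kd \<beta> k (?I k))"
      if k: "j0 < k" "k \<le> j" for k
    proof -
      \<comment> \<open>Here the size of \<open>C\<close> pays off: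
        \<open>e k < 1 / 10 \<le> C * \<delta>\<close>, and cancelling \<open>C\<close> leaves the
        premise of the two-grid estimate.\<close>
      have "C * (inverse \<beta> * g k) < C * \<delta>"
        using e_less[of k] k C(3) by (simp add: e_def mult.assoc)
      then have "inverse \<beta> * g k < \<delta>"
        using C(1) by (simp only: mult_less_cancel_left_pos)
      then have premise: "inverse \<beta> * (mesh_size T N k + mu_jump T N k (?I k) k) < \<delta>"
        using k(2) by (simp add: g_def mu_jump_inactive)
      have "spectral_dist (pc_space T k (?I k))
          (interp T \<beta> k (?I k) (inactive T N k (?I k) (k - 1))
            (hessian_inv T N Kd \<beta> (k - 1) (inactive T N k (?I k) (k - 1))))
          (hessian_inv T N Kd \<beta> k (?I k))
        \<le> ennreal (C * inverse \<beta> * (mesh_size T N k + mu_jump T N k (?I k) k))"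
        using est[OF b] sub[OF k(2)] premise k j unfolding two_grid_estimate_def by auto
      then have dist: "spectral_dist (pc_space T k (?I k))
          (interp T \<beta> k (?I k) (?I (k - 1)) (hessian_inv T N Kd \<beta> (k - 1) (?I (k - 1))))
          (hessian_inv T N Kd \<beta> k (?I k)) \<le> ennreal (e k)"
        using k(2) by (simp add: e_def g_def mu_jump_inactive inactive_pred)
      have "spd_on (pc_space T (k - 1) (?I (k - 1)))
          (hessian_inv T N Kd \<beta> (k - 1) (?I (k - 1)))"
        using Kd[of "k - 1"] sub[of "k - 1"] beta k j by (intro spd_on_hessian_inv) auto
      then have spd1: "spd_on (pc_space T k (?I k))
          (interp T \<beta> k (?I k) (?I (k - 1)) (hessian_inv T N Kd \<beta> (k - 1) (?I (k - 1))))"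
        using fin k(2) beta by (intro spd_on_interp) auto
      have spd2: "spd_on (pc_space T k (?I k)) (hessian_inv T N Kd \<beta> k (?I k))"
        using Kd[of k] sub[of k] beta k j by (intro spd_on_hessian_inv) auto
      have "0 \<le> e k" using e_nonneg k j by simp
      with dist show ?thesis
        by (simp add: spectral_dist_le_iff_form_close[OF spd1 spd2])
    qed
    have e_step: "8 * (e k)\<^sup>2 \<le> e (k + 1)" if k: "j0 < k" "k < j" for k
    proof -
      \<comment> \<open>The source of the threshold \<open>f / 8\<close>: one factor of the squared
        error absorbs the 8 and leaves \<open>f\<close>, the most that \<open>e\<close> can shrink
        per level.\<close>
      have "8 * e k * e k \<le> f * e k"
        using e_less[of k] e_nonneg[of k] k j by (intro mult_right_mono) auto
      also have "\<dots> \<le> e (k + 1)"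
        using e_mono(2)[of k] k by simp
      finally show ?thesis by (simp add: power2_eq_square)
    qed
    have e_small: "0 \<le> e k" "e k \<le> 1 / 10" if "j0 < k" "k \<le> j" for k
      using e_nonneg[of k] e_less[of k] that j by auto
    note mg = mg_precond_close[OF Kd beta j I tg e_small e_step, simplified]
    have "spd_on (pc_space T j I) (hessian_inv T N Kd \<beta> j I)"
      using Kd[of j] I beta j by (intro spd_on_hessian_inv) auto
    moreover have "0 \<le> 2 * e j" using e_nonneg j by simp
    ultimately have "spectral_dist (pc_space T j I) (mg_precond T N Kd \<beta> j I j0)
        (hessian_inv T N Kd \<beta> j I) \<le> ennreal (2 * e j)"
      using mg by (simp only: spectral_dist_le_iff_form_close)
    then show ?thesis
      using mg(1) by (simp add: e_def g_def mult.assoc)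
  qed
  have "0 < 2 * C" using C(1) by simp
  with main have "\<exists>C_mg>0. \<forall>\<beta>\<in>B. \<forall>(j0::int) (j::int) (I::nat set) (f::real).
       0 \<le> j0 \<and> j0 < j \<and> I \<subseteq> {1..N j} \<and> 0 < f \<and> f \<le> f_low \<and>
       (\<forall>k\<in>{j0 + 1..j}. mu_jump T N j I k \<le> mu_jump T N j I (k - 1) \<and>
                         mu_jump T N j I (k - 1) \<le> inverse f * mu_jump T N j I k) \<and>
       C * inverse \<beta> * (mesh_size T N j0 + mu_jump T N j I j0) < min (1 / 10) (f / 8)
       \<longrightarrow> spd_on (pc_space T j I) (mg_precond T N Kd \<beta> j I j0) \<and>
           spectral_dist (pc_space T j I) (mg_precond T N Kd \<beta> j I j0) (hessian_inv T N Kd \<beta> j I)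
             \<le> ennreal (C_mg * inverse \<beta> * (mesh_size T N j + mu_jump T N j I j))"
    by (intro exI[of _ "2 * C"]) blast
  with \<delta> C(1) est show ?thesis by blast
qed

end
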